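(* Let $F$ be a group, $I$ an index set, and for each $i\in I$ let $H_i,H_i'\le F$ be subgroups with an isomorphism $H_i\to H_i'$. Let $G=F*_{H_i^{t_i}=H_i'}$ be the corresponding multiple HNN extension, where for each $i\in I$ the stable letter $t_i$ conjugates $H_i$ to $H_i'$ via the given isomorphism. Then $G$ is poly-free (resp. normally poly-free) if 1) $F$ is poly-free (resp. free); and 2) each isomorphism $H_i\to H_i'$ given by $t_i$ can be extended to an automorphism $\phi_i:F\to F$.
   Context: A group $G$ is poly-free if there is a finite subnormal sequence $1=G_0\trianglelefteq G_1\trianglelefteq\cdots\trianglelefteq G_n=G$ with each $G_{i+1}/G_i$ free (of possibly infinite rank). It is normally poly-free if in addition each $G_i$ can be chosen normal in $G$. *)

theory Defs
  imports "HOL-Algebra.Coset"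
begin

section \<open>Group presentations and free groups\<close>

text \<open>
  A letter \<open>(x, True)\<close> stands for the generator \<open>x\<close>, and \<open>(x, False)\<close> for its formal
  inverse; the letters of a word need not be reduced.
\<close>

type_synonym 'x word = "('x \<times> bool) list"

definition words :: "'x set \<Rightarrow> 'x word set" where
  "words X = lists (X \<times> UNIV)"

inductive pres_eq :: "'x set \<Rightarrow> 'x word set \<Rightarrow> 'x word \<Rightarrow> 'x word \<Rightarrow> bool"
  for X :: "'x set" and R :: "'x word set"
where
  refl: "w \<in> words X \<Longrightarrow> pres_eq X R w w"
| sym: "pres_eq X R u v \<Longrightarrow> pres_eq X R v u"
| trans: "pres_eq X R u v \<Longrightarrow> pres_eq X R v w \<Longrightarrow> pres_eq X R u w"
| cancel: "u \<in> words X \<Longrightarrow> v \<in> words X \<Longrightarrow> x \<in> X \<Longrightarrow>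
    pres_eq X R (u @ [(x, b), (x, \<not> b)] @ v) (u @ v)"
| relator: "u \<in> words X \<Longrightarrow> v \<in> words X \<Longrightarrow> r \<in> R \<Longrightarrow> r \<in> words X \<Longrightarrow>
    pres_eq X R (u @ r @ v) (u @ v)"

definition pres_rel :: "'x set \<Rightarrow> 'x word set \<Rightarrow> ('x word \<times> 'x word) set" where
  "pres_rel X R = {(u, v). pres_eq X R u v}"

text \<open>The group \<open>\<langle>X | R\<rangle>\<close>; its elements are classes of words, multiplied by concatenation.\<close>

definition presented_group :: "'x set \<Rightarrow> 'x word set \<Rightarrow> 'x word set monoid" where
  "presented_group X R =
    \<lparr> carrier = words X // pres_rel X R,
      mult = (\<lambda>A B. \<Union>u\<in>A. \<Union>v\<in>B. pres_rel X R `` {u @ v}),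
      one = pres_rel X R `` {[]} \<rparr>"

definition free_group_on :: "'x set \<Rightarrow> 'x word set monoid" where
  "free_group_on X = presented_group X {}"

text \<open>
  Free of arbitrary, possibly infinite (or zero) rank.  Letting the abstract basis \<open>X\<close> range over
  sets of the element type of \<open>G\<close> is no restriction, since a basis of \<open>G\<close> is a subset of \<open>G\<close>.
\<close>

definition is_free :: "('a, 'b) monoid_scheme \<Rightarrow> bool" where
  "is_free G \<longleftrightarrow> group G \<and> (\<exists>X :: 'a set. G \<cong> free_group_on X)"


section \<open>Poly-free groups\<close>

definition poly_free_series ::
    "('a, 'b) monoid_scheme \<Rightarrow> nat \<Rightarrow> (nat \<Rightarrow> 'a set) \<Rightarrow> bool" where
  "poly_free_series G n N \<longleftrightarrow>
    N 0 = {\<one>\<^bsub>G\<^esub>} \<and> N n = carrier G \<and> (\<forall>i\<le>n. subgroup (N i) G) \<and>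
    (\<forall>i<n. N i \<lhd> G\<lparr>carrier := N (Suc i)\<rparr> \<and> is_free (G\<lparr>carrier := N (Suc i)\<rparr> Mod N i))"

definition poly_free :: "('a, 'b) monoid_scheme \<Rightarrow> bool" where
  "poly_free G \<longleftrightarrow> group G \<and> (\<exists>n N. poly_free_series G n N)"

definition normally_poly_free :: "('a, 'b) monoid_scheme \<Rightarrow> bool" where
  "normally_poly_free G \<longleftrightarrow>
    group G \<and> (\<exists>n N. poly_free_series G n N \<and> (\<forall>i\<le>n. N i \<lhd> G))"


section \<open>Multiple HNN extensions\<close>

text \<open>
  The HNN extension of \<open>F\<close> with stable letters \<open>t\<^sub>i\<close> (\<open>i \<in> I\<close>), base generators
  \<open>Inl f\<close> and stable letters \<open>Inr i\<close>.  The first family of relators is the multiplication table of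
  \<open>F\<close>; the second one says \<open>t\<^sub>i\<^sup>-\<^sup>1 h t\<^sub>i = \<theta>\<^sub>i(h)\<close> for \<open>h \<in> H\<^sub>i\<close>, following the convention
  \<open>h\<^sup>t = t\<^sup>-\<^sup>1 h t\<close>.
\<close>

definition hnn_relators ::
    "('a, 'b) monoid_scheme \<Rightarrow> 'i set \<Rightarrow> ('i \<Rightarrow> 'a set) \<Rightarrow> ('i \<Rightarrow> 'a \<Rightarrow> 'a) \<Rightarrow> ('a + 'i) word set" where
  "hnn_relators F I H \<theta> =
    {[(Inl a, True), (Inl b, True), (Inl (a \<otimes>\<^bsub>F\<^esub> b), False)] | a b.
        a \<in> carrier F \<and> b \<in> carrier F} \<union>
    {[(Inr i, False), (Inl h, True), (Inr i, True), (Inl (\<theta> i h), False)] | i h.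
        i \<in> I \<and> h \<in> H i}"

definition hnn_extension ::
    "('a, 'b) monoid_scheme \<Rightarrow> 'i set \<Rightarrow> ('i \<Rightarrow> 'a set) \<Rightarrow> ('i \<Rightarrow> 'a \<Rightarrow> 'a) \<Rightarrow> ('a + 'i) word set monoid" where
  "hnn_extension F I H \<theta> = presented_group (carrier F <+> I) (hnn_relators F I H \<theta>)"

end

theory Submission
  imports Defs "HOL-Algebra.Bij" "HOL-Algebra.Generated_Groups"
begin

text \<open>
  Write \<open>A\<close> for the free group on the stable letters and \<open>G\<close> for the HNN extension.
  Since the isomorphism attached to \<open>t\<^sub>i\<close> extends to an automorphism of \<open>F\<close>,
  the group \<open>G\<close> maps onto a semidirect product \<open>Q = F \<rtimes> A\<close> in which
  \<open>t\<^sub>i\<close> conjugates the whole of \<open>F\<close> by that automorphism.  Let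
  \<open>L\<close> be the kernel of \<open>\<rho> : G \<rightarrow> Q\<close>.  If \<open>L\<close> is free
  and \<open>F\<^sub>0 \<le> \<dots> \<le> F\<^sub>n\<close> is a poly-free series of \<open>F\<close>, then
  \<open>1 \<le> L = \<rho>\<^sup>-\<^sup>1(F\<^sub>0 \<times> 1) \<le> \<dots> \<le>
  \<rho>\<^sup>-\<^sup>1(F\<^sub>n \<times> 1) \<le> G\<close> is a poly-free series of \<open>G\<close>: the
  factors are \<open>L\<close>, the factors of \<open>F\<close>, and \<open>A\<close>.  If \<open>F\<close> is
  free, take the series \<open>1 \<le> F\<close> for \<open>F\<close>; all that occurs then are
  \<open>1\<close>, the kernels of \<open>G \<rightarrow> Q\<close> and \<open>G \<rightarrow> A\<close>, and
  \<open>G\<close> itself, which are normal in \<open>G\<close>.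

  The substance is the freeness of \<open>L\<close>.  Geometrically, \<open>L\<close> meets the conjugates of
  \<open>F\<close> trivially, so it acts freely on the Bass--Serre tree of \<open>G\<close>, and
  \<open>L\<close> is the fundamental group of the quotient graph. The vertices of this graph are the orbits
  of \<open>F\<close> in \<open>Q\<close>, one for every \<open>w\<close> in \<open>A\<close>, and for each
  \<open>i\<close> and \<open>w\<close> in \<open>A\<close> one edge from \<open>w\<close> to \<open>t\<^sub>i
  w\<close> for every coset of \<open>H'\<^sub>i\<close> in \<open>F\<close>.  The edges of the trivial cosets
  form the Cayley tree of \<open>A\<close>, a spanning tree, so the triples \<open>(i, C, w)\<close> with
  \<open>C\<close> a nontrivial coset should index a basis of \<open>L\<close>.

  The proof turns this picture into algebra and uses neither trees nor normal forms.  Let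
  \<open>\<Phi>\<close> be the free group on those triples, and label the edge \<open>q \<mapsto> t\<^sub>i
  q\<close> of \<open>Q\<close> by the corresponding generator of \<open>\<Phi>\<close>, or by
  \<open>1\<close> on the spanning tree.  The labels are invariant under \<open>H'\<^sub>i\<close>, which is
  exactly what is needed for the relations of \<open>G\<close> to hold in the wreath product of
  \<open>\<Phi>\<close> by \<open>Q\<close>; hence \<open>G\<close> maps to the wreath product (lemma
  \<open>\<tau>\<close>), and evaluation of the first component at \<open>1\<close> gives a homomorphism
  \<open>L \<rightarrow> \<Phi>\<close>.  It is surjective since each generator of \<open>\<Phi>\<close> is
  the label of a loop.  It is injective because the Schreier generators of \<open>L\<close> define a map
  \<open>\<iota> : \<Phi> \<rightarrow> G\<close> with which every element of \<open>L\<close> can be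
  recovered from its label (lemma \<open>mult_transversal\<close>).
\<close>

section \<open>Groups given by generators and relators\<close>

definition word_class :: "'x set \<Rightarrow> 'x word set \<Rightarrow> 'x word \<Rightarrow> 'x word set" where
  "word_class X R w = pres_rel X R `` {w}"

definition generator :: "'x set \<Rightarrow> 'x word set \<Rightarrow> 'x \<Rightarrow> 'x word set" where
  "generator X R x = word_class X R [(x, True)]"

definition inverse_word :: "'x word \<Rightarrow> 'x word" where
  "inverse_word w = rev (map (\<lambda>(x, b). (x, \<not> b)) w)"

fun word_value :: "('a, 'b) monoid_scheme \<Rightarrow> ('x \<Rightarrow> 'a) \<Rightarrow> 'x word \<Rightarrow> 'a" where
  "word_value M f [] = \<one>\<^bsub>M\<^esub>"
| "word_value M f ((x, b) # w) = (if b then f x else inv\<^bsub>M\<^esub> f x) \<otimes>\<^bsub>M\<^esub> word_value M f w"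

lemma words_simps [simp]:
  "[] \<in> words X"
  "(x, b) # w \<in> words X \<longleftrightarrow> x \<in> X \<and> w \<in> words X"
  "u @ v \<in> words X \<longleftrightarrow> u \<in> words X \<and> v \<in> words X"
  by (auto simp: words_def)

lemma inverse_word_in_words [simp]: "w \<in> words X \<Longrightarrow> inverse_word w \<in> words X"
  by (auto simp: words_def inverse_word_def)

lemma pres_eq_in_words: "pres_eq X R u v \<Longrightarrow> u \<in> words X \<and> v \<in> words X"
  by (induction rule: pres_eq.induct) auto

lemma equiv_pres_rel: "equiv (words X) (pres_rel X R)"
  by (rule equivI)
     (auto simp: pres_rel_def refl_on_def sym_def trans_def dest: pres_eq_in_words
       intro: pres_eq.refl pres_eq.sym pres_eq.trans)

lemma pres_eq_append:
  assumes "pres_eq X R u u'" "a \<in> words X" "b \<in> words X"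
  shows "pres_eq X R (a @ u @ b) (a @ u' @ b)"
  using assms
proof (induction rule: pres_eq.induct)
  case (cancel u v x c)
  then show ?case
    using pres_eq.cancel[of "a @ u" X "v @ b" x R c] by simp
next
  case (relator u v r)
  then show ?case
    using pres_eq.relator[of "a @ u" X "v @ b" r R] by simp
qed (auto intro: pres_eq.refl pres_eq.sym pres_eq.trans)

lemma pres_eq_append2:
  assumes "pres_eq X R u u'" "pres_eq X R v v'"
  shows "pres_eq X R (u @ v) (u' @ v')"
  using pres_eq_append[OF assms(1), of "[]" v] pres_eq_append[OF assms(2), of u' "[]"]
    assms[THEN pres_eq_in_words]
  by (auto intro: pres_eq.trans)

lemma word_class_eq_iff:
  "\<lbrakk>u \<in> words X; v \<in> words X\<rbrakk> \<Longrightarrow> word_class X R u = word_class X R v \<longleftrightarrow> pres_eq X R u v"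
  unfolding word_class_def using eq_equiv_class_iff[OF equiv_pres_rel, of u X v R]
  by (simp add: pres_rel_def)

lemma carrier_presented_group: "carrier (presented_group X R) = word_class X R ` words X"
  by (auto simp: presented_group_def quotient_def word_class_def)

lemma one_presented_group: "\<one>\<^bsub>presented_group X R\<^esub> = word_class X R []"
  by (simp add: presented_group_def word_class_def)

text \<open>
  Multiplication is defined by a union over representatives; this is a single class because concatenation
  respects the congruence on both sides.
\<close>

lemma word_class_mult:
  assumes "u \<in> words X" "v \<in> words X"
  shows "word_class X R u \<otimes>\<^bsub>presented_group X R\<^esub> word_class X R v = word_class X R (u @ v)"
proof -
  have "congruent2 (pres_rel X R) (pres_rel X R) (\<lambda>u v. pres_rel X R `` {u @ v})"
  proof (rule congruent2I[OF equiv_pres_rel equiv_pres_rel])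
    show "pres_rel X R `` {u @ w} = pres_rel X R `` {v @ w}"
      if "w \<in> words X" "(u, v) \<in> pres_rel X R" for u v w
      using that pres_eq_in_words[of X R u v]
      by (intro equiv_class_eq[OF equiv_pres_rel]) (auto simp: pres_rel_def intro: pres_eq_append2 pres_eq.refl)
    show "pres_rel X R `` {w @ u} = pres_rel X R `` {w @ v}"
      if "w \<in> words X" "(u, v) \<in> pres_rel X R" for u v w
      using that pres_eq_in_words[of X R u v]
      by (intro equiv_class_eq[OF equiv_pres_rel]) (auto simp: pres_rel_def intro: pres_eq_append2 pres_eq.refl)
  qed
  from UN_equiv_class2[OF equiv_pres_rel equiv_pres_rel this assms]
  show ?thesis by (simp add: presented_group_def word_class_def)
qed

lemma pres_eq_inverse_word: "w \<in> words X \<Longrightarrow> pres_eq X R (inverse_word w @ w) []"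
proof (induction w)
  case Nil
  then show ?case by (simp add: inverse_word_def pres_eq.refl)
next
  case (Cons a w)
  obtain x b where a: "a = (x, b)" by force
  with Cons have w: "w \<in> words X" "x \<in> X" by auto
  have "pres_eq X R (inverse_word w @ [(x, \<not> b), (x, \<not> \<not> b)] @ w) (inverse_word w @ w)"
    using w by (intro pres_eq.cancel) auto
  then show ?case
    using Cons.IH[OF w(1)] by (auto simp: a inverse_word_def intro: pres_eq.trans)
qed

lemma group_presented_group: "group (presented_group X R)"
proof (rule groupI)
  show "\<exists>y\<in>carrier (presented_group X R). y \<otimes>\<^bsub>presented_group X R\<^esub> x = \<one>\<^bsub>presented_group X R\<^esub>"
    if x: "x \<in> carrier (presented_group X R)" for x
  proof -
    obtain w where w: "w \<in> words X" "x = word_class X R w"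
      using x by (auto simp: carrier_presented_group)
    then show ?thesis
      using pres_eq_inverse_word[OF w(1)]
      by (intro bexI[of _ "word_class X R (inverse_word w)"])
         (auto simp: carrier_presented_group word_class_mult word_class_eq_iff one_presented_group)
  qed
qed (auto simp: carrier_presented_group word_class_mult one_presented_group)

lemma generator_in_carrier [simp, intro]:
  "x \<in> X \<Longrightarrow> generator X R x \<in> carrier (presented_group X R)"
  by (auto simp: generator_def carrier_presented_group)

lemma inv_generator:
  assumes "x \<in> X"
  shows "inv\<^bsub>presented_group X R\<^esub> generator X R x = word_class X R [(x, False)]"
proof -
  interpret group "presented_group X R" by (rule group_presented_group)
  have "pres_eq X R ([] @ [(x, False), (x, \<not> False)] @ []) ([] @ [])"
    using assms by (intro pres_eq.cancel) auto
  then show ?thesis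
    using assms
    by (intro inv_equality)
       (auto simp: generator_def carrier_presented_group word_class_mult one_presented_group word_class_eq_iff)
qed

lemma word_value_generator:
  "w \<in> words X \<Longrightarrow> word_value (presented_group X R) (generator X R) w = word_class X R w"
proof (induction w)
  case (Cons a w)
  then show ?case
    by (cases a) (auto simp: inv_generator word_class_mult generator_def[symmetric]
        word_class_mult[of "[(x, True)]" X for x, folded generator_def, simplified]
        word_class_mult[of "[(x, False)]" X for x, simplified])
qed (simp add: one_presented_group)

lemma relator_value:
  assumes "r \<in> R" "r \<in> words X"
  shows "word_value (presented_group X R) (generator X R) r = \<one>\<^bsub>presented_group X R\<^esub>"
  using pres_eq.relator[of "[]" X "[]" r R] assms
  by (simp add: word_value_generator one_presented_group word_class_eq_iff)

context group begin

lemma word_value_closed [simp, intro]: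
  "\<lbrakk>f \<in> X \<rightarrow> carrier G; w \<in> words X\<rbrakk> \<Longrightarrow> word_value G f w \<in> carrier G"
  by (induction w) (auto simp: Pi_iff)

lemma word_value_append:
  "\<lbrakk>f \<in> X \<rightarrow> carrier G; u \<in> words X; v \<in> words X\<rbrakk> \<Longrightarrow>
    word_value G f (u @ v) = word_value G f u \<otimes> word_value G f v"
proof (induction u)
  case (Cons a u)
  then show ?case by (cases a) (auto simp: m_assoc Pi_iff word_value_closed[of f X])
qed (auto simp: word_value_closed[of f X])

lemma word_value_pres_eq:
  assumes "pres_eq X R u v" and f: "f \<in> X \<rightarrow> carrier G"
    and R: "\<And>r. r \<in> R \<Longrightarrow> r \<in> words X \<Longrightarrow> word_value G f r = \<one>"
  shows "word_value G f u = word_value G f v"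
  using assms(1)
proof (induction rule: pres_eq.induct)
  case (cancel u v x b)
  have "word_value G f [(x, b), (x, \<not> b)] = \<one>"
    using cancel f by (cases b) (auto simp: Pi_iff)
  then show ?case
    using cancel f word_value_append[OF f, of u "[(x, b), (x, \<not> b)] @ v"]
      word_value_append[OF f, of "[(x, b), (x, \<not> b)]" v]
    by (auto simp: word_value_append[OF f] word_value_closed[OF f] simp del: word_value.simps append_Cons)
next
  case (relator u v r)
  then show ?case
    by (auto simp: word_value_append[OF f] word_value_closed[OF f] R)
qed simp_all

text \<open>
  Von Dyck's theorem: evaluation of words in \<open>G\<close> is constant on classes, since each generating
  step of the congruence inserts a word with value \<open>1\<close>.
\<close>

theorem presented_group_universal:
  assumes f: "f \<in> X \<rightarrow> carrier G"
    and R: "\<And>r. r \<in> R \<Longrightarrow> r \<in> words X \<Longrightarrow> word_value G f r = \<one>"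
  obtains h where "h \<in> hom (presented_group X R) G"
    and "\<And>x. x \<in> X \<Longrightarrow> h (generator X R x) = f x"
proof -
  define h where "h A = word_value G f (SOME w. w \<in> words X \<and> A = word_class X R w)" for A
  have h: "h (word_class X R w) = word_value G f w" if "w \<in> words X" for w
  proof -
    have "\<exists>v. v \<in> words X \<and> word_class X R w = word_class X R v" using that by auto
    from someI_ex[OF this] show ?thesis
      unfolding h_def using that
      by (intro word_value_pres_eq[OF _ f R]) (auto simp: word_class_eq_iff intro: pres_eq.sym)
  qed
  show ?thesis
  proof
    show "h \<in> hom (presented_group X R) G"
      by (rule homI) (auto simp: carrier_presented_group word_class_mult h word_value_append[OF f] word_value_closed[OF f])
    show "h (generator X R x) = f x" if "x \<in> X" for x
      using that f by (auto simp: generator_def h Pi_iff)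
  qed
qed

end

definition induced_hom ::
    "'x set \<Rightarrow> 'x word set \<Rightarrow> ('a, 'b) monoid_scheme \<Rightarrow> ('x \<Rightarrow> 'a) \<Rightarrow> 'x word set \<Rightarrow> 'a" where
  "induced_hom X R M f =
    (SOME h. h \<in> hom (presented_group X R) M \<and> (\<forall>x\<in>X. h (generator X R x) = f x))"

lemma induced_hom:
  assumes M: "group M" and f: "f \<in> X \<rightarrow> carrier M"
    and R: "\<And>r. r \<in> R \<Longrightarrow> r \<in> words X \<Longrightarrow> word_value M f r = \<one>\<^bsub>M\<^esub>"
  shows "induced_hom X R M f \<in> hom (presented_group X R) M"
    and "x \<in> X \<Longrightarrow> induced_hom X R M f (generator X R x) = f x"
proof -
  obtain h where "h \<in> hom (presented_group X R) M" "\<And>x. x \<in> X \<Longrightarrow> h (generator X R x) = f x"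
    using group.presented_group_universal[OF M f R] by blast
  then have "\<exists>h. h \<in> hom (presented_group X R) M \<and> (\<forall>x\<in>X. h (generator X R x) = f x)" by blast
  from someI_ex[OF this]
  show "induced_hom X R M f \<in> hom (presented_group X R) M"
    and "x \<in> X \<Longrightarrow> induced_hom X R M f (generator X R x) = f x"
    by (auto simp: induced_hom_def)
qed

text \<open>
  All later facts about every element of a presented group come from this lemma: the elements having a
  suitable property form a subgroup, and only the generators remain to be checked.
\<close>

lemma presented_group_generated:
  assumes S: "subgroup S (presented_group X R)"
    and gen: "\<And>x. x \<in> X \<Longrightarrow> generator X R x \<in> S"
  shows "carrier (presented_group X R) \<subseteq> S"
proof -
  have "word_value (presented_group X R) (generator X R) w \<in> S" if "w \<in> words X" for w
    using that
  proof (induction w)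
    case (Cons a w)
    then show ?case
      using S gen by (cases a) (auto intro: subgroup.m_closed subgroup.m_inv_closed)
  qed (use S in \<open>auto intro: subgroup.one_closed\<close>)
  then show ?thesis by (auto simp: carrier_presented_group word_value_generator)
qed

section \<open>Free groups\<close>

lemma hom_eq_on_generators:
  assumes M: "group M"
    and h: "h \<in> hom (presented_group X R) M" and k: "k \<in> hom (presented_group X R) M"
    and eq: "\<And>x. x \<in> X \<Longrightarrow> h (generator X R x) = k (generator X R x)"
    and g: "g \<in> carrier (presented_group X R)"
  shows "h g = k g"
proof -
  let ?P = "presented_group X R"
  interpret h: group_hom ?P M h
    using group_presented_group M h by (simp add: group_hom_def group_hom_axioms_def)
  interpret k: group_hom ?P M k
    using group_presented_group M k by (simp add: group_hom_def group_hom_axioms_def)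
  have "subgroup {g \<in> carrier ?P. h g = k g} ?P"
    by unfold_locales auto
  from presented_group_generated[OF this] eq g show ?thesis by auto
qed

lemma group_free_group_on: "group (free_group_on X)"
  by (simp add: free_group_on_def group_presented_group)

text \<open>
  Cancelling pairs do not change the parity of the number of letters \<open>x\<close> or
  \<open>x\<^sup>-\<^sup>1\<close>, and this invariant tells \<open>x\<close> from every other generator.
\<close>

lemma inj_free_generator: "inj_on (generator X {}) X"
proof (rule inj_onI)
  fix x y
  assume xy: "x \<in> X" "y \<in> X" "generator X {} x = generator X {} y"
  define parity where "parity w = even (length (filter (\<lambda>a. fst a = x) w))" for w :: "('a \<times> bool) list"
  have "parity u = parity v" if "pres_eq X {} u v" for u v
    using that by (induction rule: pres_eq.induct) (auto simp: parity_def)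
  moreover have "pres_eq X {} [(x, True)] [(y, True)]"
    using xy by (simp add: generator_def word_class_eq_iff)
  ultimately have "parity [(x, True)] = parity [(y, True)]" .
  then show "x = y" by (simp add: parity_def split: if_splits)
qed

lemma free_group_on_image:
  assumes f: "inj_on f X"
  shows "free_group_on X \<cong> free_group_on (f ` X)"
proof -
  let ?g = "inv_into X f" and ?P = "free_group_on X" and ?P' = "free_group_on (f ` X)"
  interpret P: group ?P by (rule group_free_group_on)
  interpret P': group ?P' by (rule group_free_group_on)
  obtain h where h: "h \<in> hom ?P ?P'" "\<And>x. x \<in> X \<Longrightarrow> h (generator X {} x) = generator (f ` X) {} (f x)"
    using P'.presented_group_universal[of "\<lambda>x. generator (f ` X) {} (f x)" X "{}"]
    by (auto simp: free_group_on_def Pi_iff)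
  obtain k where k: "k \<in> hom ?P' ?P" "\<And>y. y \<in> f ` X \<Longrightarrow> k (generator (f ` X) {} y) = generator X {} (?g y)"
    using P.presented_group_universal[of "\<lambda>y. generator X {} (?g y)" "f ` X" "{}"]
    by (auto simp: free_group_on_def Pi_iff inv_into_into)
  have "(k \<circ> h) a = id a" if "a \<in> carrier ?P" for a
    using that hom_compose[OF h(1) k(1)] id_iso[of ?P] P.is_group h(2) k(2) f
    by (intro hom_eq_on_generators[of ?P "k \<circ> h" X "{}" id a]) (auto simp: free_group_on_def iso_def)
  moreover have "(h \<circ> k) a = id a" if "a \<in> carrier ?P'" for a
    using that hom_compose[OF k(1) h(1)] id_iso[of ?P'] P'.is_group h(2) k(2) f
    by (intro hom_eq_on_generators[of ?P' "h \<circ> k" "f ` X" "{}" id a]) (auto simp: free_group_on_def iso_def)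
  ultimately have "group_isomorphisms ?P ?P' h k"
    using h(1) k(1) by (auto simp: group_isomorphisms_def)
  then show ?thesis by (auto simp: is_iso_def dest: group_isomorphisms_imp_iso)
qed

text \<open>
  Freeness is defined with a basis whose elements have the type of the group.  A basis of another type can be
  moved there: its generators are distinct in \<open>G\<close>, so their images in \<open>G\<close> can serve
  as names.
\<close>

lemma is_freeI:
  fixes X :: "'x set" and G :: "('a, 'b) monoid_scheme"
  assumes G: "group G" and iso: "free_group_on X \<cong> G"
  shows "is_free G"
proof -
  obtain h where h: "h \<in> iso (free_group_on X) G" using iso by (auto simp: is_iso_def)
  let ?b = "\<lambda>x. h (generator X {} x)"
  have "inj_on h (carrier (free_group_on X))" using h by (auto simp: iso_def bij_betw_def)
  then have "inj_on ?b X"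
    using inj_free_generator[of X]
    by (auto simp: inj_on_def free_group_on_def generator_in_carrier)
  then have "free_group_on X \<cong> free_group_on (?b ` X)" by (rule free_group_on_image)
  moreover have "G \<cong> free_group_on X" using group.iso_sym[OF group_free_group_on iso] .
  ultimately have "G \<cong> free_group_on (?b ` X)" by (rule iso_trans[rotated])
  then show ?thesis using G by (auto simp: is_free_def)
qed

lemma is_free_iso:
  assumes "is_free G" "G \<cong> K" "group K"
  shows "is_free K"
proof -
  obtain X :: "'a set" where X: "G \<cong> free_group_on X" and G: "group G"
    using assms(1) by (auto simp: is_free_def)
  show ?thesis
    using iso_trans[OF group.iso_sym[OF G X] assms(2)] assms(3) by (intro is_freeI)
qed

section \<open>Semidirect and wreath products\<close>

definition semidirect_product ::
    "('n, 'c) monoid_scheme \<Rightarrow> ('k, 'd) monoid_scheme \<Rightarrow> ('k \<Rightarrow> 'n \<Rightarrow> 'n) \<Rightarrow> ('n \<times> 'k) monoid" where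
  "semidirect_product N K \<alpha> =
    \<lparr> carrier = carrier N \<times> carrier K,
      mult = (\<lambda>(n, k) (n', k'). (n \<otimes>\<^bsub>N\<^esub> \<alpha> k n', k \<otimes>\<^bsub>K\<^esub> k')),
      one = (\<one>\<^bsub>N\<^esub>, \<one>\<^bsub>K\<^esub>) \<rparr>"

lemma carrier_AutoGroup: "f \<in> carrier (AutoGroup N) \<longleftrightarrow> f \<in> iso N N \<and> f \<in> extensional (carrier N)"
  by (auto simp: AutoGroup_def auto_def Bij_def iso_def)

lemma AutoGroup_mult_apply:
  "\<lbrakk>f \<in> carrier (AutoGroup N); g \<in> carrier (AutoGroup N); x \<in> carrier N\<rbrakk> \<Longrightarrow>
    (f \<otimes>\<^bsub>AutoGroup N\<^esub> g) x = f (g x)"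
  by (auto simp: AutoGroup_def BijGroup_def auto_def compose_def)

lemma AutoGroup_one_apply: "x \<in> carrier N \<Longrightarrow> \<one>\<^bsub>AutoGroup N\<^esub> x = x"
  by (auto simp: AutoGroup_def BijGroup_def)

locale group_action_by_automorphisms = N: group N + K: group K
  for N (structure) and K (structure) +
  fixes \<alpha>
  assumes action: "\<alpha> \<in> hom K (AutoGroup N)"
begin

lemma action_hom: "k \<in> carrier K \<Longrightarrow> \<alpha> k \<in> hom N N"
  using hom_in_carrier[OF action, of k] by (simp add: carrier_AutoGroup iso_def)

lemma action_simps [simp]:
  "\<lbrakk>k \<in> carrier K; n \<in> carrier N\<rbrakk> \<Longrightarrow> \<alpha> k n \<in> carrier N"
  "\<lbrakk>k \<in> carrier K; n \<in> carrier N; n' \<in> carrier N\<rbrakk> \<Longrightarrow> \<alpha> k (n \<otimes>\<^bsub>N\<^esub> n') = \<alpha> k n \<otimes>\<^bsub>N\<^esub> \<alpha> k n'"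
  "\<lbrakk>k \<in> carrier K; k' \<in> carrier K; n \<in> carrier N\<rbrakk> \<Longrightarrow> \<alpha> (k \<otimes>\<^bsub>K\<^esub> k') n = \<alpha> k (\<alpha> k' n)"
  "n \<in> carrier N \<Longrightarrow> \<alpha> \<one>\<^bsub>K\<^esub> n = n"
  "k \<in> carrier K \<Longrightarrow> \<alpha> k \<one>\<^bsub>N\<^esub> = \<one>\<^bsub>N\<^esub>"
proof -
  show "\<alpha> k n \<in> carrier N" if "k \<in> carrier K" "n \<in> carrier N"
    using hom_in_carrier[OF action_hom] that .
  show "\<alpha> k (n \<otimes>\<^bsub>N\<^esub> n') = \<alpha> k n \<otimes>\<^bsub>N\<^esub> \<alpha> k n'"
    if "k \<in> carrier K" "n \<in> carrier N" "n' \<in> carrier N"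
    using hom_mult[OF action_hom] that .
  show "\<alpha> (k \<otimes>\<^bsub>K\<^esub> k') n = \<alpha> k (\<alpha> k' n)"
    if "k \<in> carrier K" "k' \<in> carrier K" "n \<in> carrier N"
    using that by (simp add: hom_mult[OF action] hom_in_carrier[OF action] AutoGroup_mult_apply)
  show "\<alpha> \<one>\<^bsub>K\<^esub> n = n" if "n \<in> carrier N"
    using that by (simp add: hom_one[OF action K.is_group N.AutoGroup] AutoGroup_one_apply)
  show "\<alpha> k \<one>\<^bsub>N\<^esub> = \<one>\<^bsub>N\<^esub>" if "k \<in> carrier K"
    using hom_one[OF action_hom[OF that] N.is_group N.is_group] .
qed

lemma group_semidirect_product: "group (semidirect_product N K \<alpha>)"
proof (rule groupI)
  fix x
  assume "x \<in> carrier (semidirect_product N K \<alpha>)"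
  then obtain n k where x: "x = (n, k)" "n \<in> carrier N" "k \<in> carrier K"
    by (auto simp: semidirect_product_def)
  have "\<alpha> (inv\<^bsub>K\<^esub> k) (inv\<^bsub>N\<^esub> n) \<otimes>\<^bsub>N\<^esub> \<alpha> (inv\<^bsub>K\<^esub> k) n = \<one>\<^bsub>N\<^esub>"
    using x by (subst action_simps(2)[symmetric]) auto
  with x show "\<exists>y\<in>carrier (semidirect_product N K \<alpha>).
      y \<otimes>\<^bsub>semidirect_product N K \<alpha>\<^esub> x = \<one>\<^bsub>semidirect_product N K \<alpha>\<^esub>"
    by (intro bexI[of _ "(\<alpha> (inv\<^bsub>K\<^esub> k) (inv\<^bsub>N\<^esub> n), inv\<^bsub>K\<^esub> k)"]) (auto simp: semidirect_product_def)
qed (auto simp: semidirect_product_def N.m_assoc K.m_assoc)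

end

text \<open>
  The unrestricted wreath product over the left regular action of \<open>Q\<close>.  The pair \<open>(b,
  q)\<close> stands for the permutation \<open>(x, y) \<mapsto> (q x, b(x) y)\<close> of \<open>Q \<times>
  P\<close>, and the product is composition; so first components multiply like cocycles.
\<close>

definition wreath_product ::
    "('p, 'c) monoid_scheme \<Rightarrow> ('q, 'd) monoid_scheme \<Rightarrow> (('q \<Rightarrow> 'p) \<times> 'q) monoid" where
  "wreath_product P Q =
    \<lparr> carrier = (carrier Q \<rightarrow>\<^sub>E carrier P) \<times> carrier Q,
      mult = (\<lambda>(b, q) (b', q'). (\<lambda>x\<in>carrier Q. b (q' \<otimes>\<^bsub>Q\<^esub> x) \<otimes>\<^bsub>P\<^esub> b' x, q \<otimes>\<^bsub>Q\<^esub> q')),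
      one = (\<lambda>x\<in>carrier Q. \<one>\<^bsub>P\<^esub>, \<one>\<^bsub>Q\<^esub>) \<rparr>"

lemma group_wreath_product:
  assumes "group P" "group Q"
  shows "group (wreath_product P Q)"
proof -
  interpret P: group P by fact
  interpret Q: group Q by fact
  have closed: "b x \<in> carrier P" if "b \<in> carrier Q \<rightarrow>\<^sub>E carrier P" "x \<in> carrier Q" for b x
    using that by auto
  show ?thesis
  proof (rule groupI)
    fix z
    assume "z \<in> carrier (wreath_product P Q)"
    then obtain b q where z: "z = (b, q)" "b \<in> carrier Q \<rightarrow>\<^sub>E carrier P" "q \<in> carrier Q"
      by (auto simp: wreath_product_def)
    have "inv\<^bsub>P\<^esub> b (inv\<^bsub>Q\<^esub> q \<otimes>\<^bsub>Q\<^esub> (q \<otimes>\<^bsub>Q\<^esub> x)) = inv\<^bsub>P\<^esub> b x" if "x \<in> carrier Q" for x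
      using that z by (simp add: Q.m_assoc[symmetric])
    with z show "\<exists>y\<in>carrier (wreath_product P Q).
        y \<otimes>\<^bsub>wreath_product P Q\<^esub> z = \<one>\<^bsub>wreath_product P Q\<^esub>"
      by (intro bexI[of _ "(\<lambda>x\<in>carrier Q. inv\<^bsub>P\<^esub> b (inv\<^bsub>Q\<^esub> q \<otimes>\<^bsub>Q\<^esub> x), inv\<^bsub>Q\<^esub> q)"])
         (auto simp: wreath_product_def closed cong: restrict_cong)
  next
    fix z
    assume "z \<in> carrier (wreath_product P Q)"
    then obtain b q where z: "z = (b, q)" "b \<in> carrier Q \<rightarrow>\<^sub>E carrier P" "q \<in> carrier Q"
      by (auto simp: wreath_product_def)
    have "(\<lambda>x\<in>carrier Q. \<one>\<^bsub>P\<^esub> \<otimes>\<^bsub>P\<^esub> b x) = restrict b (carrier Q)"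
      using z by (intro restrict_ext) (simp add: closed)
    also have "\<dots> = b" using z by (simp add: PiE_restrict)
    finally show "\<one>\<^bsub>wreath_product P Q\<^esub> \<otimes>\<^bsub>wreath_product P Q\<^esub> z = z"
      using z by (simp add: wreath_product_def cong: restrict_cong)
  next
    fix x y z
    assume "x \<in> carrier (wreath_product P Q)" "y \<in> carrier (wreath_product P Q)"
      "z \<in> carrier (wreath_product P Q)"
    then show "x \<otimes>\<^bsub>wreath_product P Q\<^esub> y \<otimes>\<^bsub>wreath_product P Q\<^esub> z =
        x \<otimes>\<^bsub>wreath_product P Q\<^esub> (y \<otimes>\<^bsub>wreath_product P Q\<^esub> z)"
      by (auto simp: wreath_product_def closed Q.m_assoc P.m_assoc cong: restrict_cong)
  qed (auto simp: wreath_product_def closed)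
qed

section \<open>Normal subgroups pulled back along a surjection\<close>

text \<open>
  The preimage is the kernel of the composite \<open>A \<rightarrow> B \<rightarrow> B/N\<close>, so both
  claims come from the first isomorphism theorem.
\<close>

lemma preimage_normal_and_factor:
  assumes hom: "group_hom A B h" and surj: "h ` carrier A = carrier B" and N: "N \<lhd> B"
  defines "M \<equiv> {a \<in> carrier A. h a \<in> N}"
  shows "M \<lhd> A" and "A Mod M \<cong> B Mod N"
proof -
  interpret h: group_hom A B h by fact
  interpret N: normal N B by fact
  let ?k = "\<lambda>a. N #>\<^bsub>B\<^esub> h a"
  have k: "?k \<in> hom A (B Mod N)"
    using hom_compose[OF h.homh N.r_coset_hom_Mod] by (simp add: comp_def)
  have k_hom: "group_hom A (B Mod N) ?k"
    using k N.factorgroup_is_group h.G.is_group by (simp add: group_hom_def group_hom_axioms_def)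
  have ker: "kernel A (B Mod N) ?k = M"
  proof -
    have "N #>\<^bsub>B\<^esub> h a = N \<longleftrightarrow> h a \<in> N" if "a \<in> carrier A" for a
    proof
      show "h a \<in> N" if "N #>\<^bsub>B\<^esub> h a = N"
        using h.H.coset_join1[OF that _ N.subgroup_axioms] \<open>a \<in> carrier A\<close> by simp
      show "N #>\<^bsub>B\<^esub> h a = N" if "h a \<in> N"
        using h.H.coset_join2[OF _ N.subgroup_axioms that] \<open>a \<in> carrier A\<close> by simp
    qed
    then show ?thesis by (auto simp: kernel_def M_def)
  qed
  show "M \<lhd> A" using group_hom.normal_kernel[OF k_hom] by (simp add: ker)
  have "?k ` carrier A = carrier (B Mod N)"
    by (simp add: carrier_FactGroup image_image flip: surj)
  from group_hom.FactGroup_iso[OF k_hom this] show "A Mod M \<cong> B Mod N" by (simp add: ker)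
qed

section \<open>HNN extensions whose stable letters extend to automorphisms\<close>

locale extendable_hnn = F: group F
  for F :: "('a, 'b) monoid_scheme" +
  fixes I :: "'i set" and H H' :: "'i \<Rightarrow> 'a set" and \<theta> \<phi> :: "'i \<Rightarrow> 'a \<Rightarrow> 'a"
  assumes H: "i \<in> I \<Longrightarrow> subgroup (H i) F"
    and H': "i \<in> I \<Longrightarrow> subgroup (H' i) F"
    and \<theta>_image: "i \<in> I \<Longrightarrow> \<theta> i ` H i = H' i"
    and \<phi>: "i \<in> I \<Longrightarrow> \<phi> i \<in> iso F F"
    and \<phi>_eq: "i \<in> I \<Longrightarrow> h \<in> H i \<Longrightarrow> \<phi> i h = \<theta> i h"
begin

text \<open>
  The images in \<open>G\<close> of the base group and of the stable letters are \<open>j f\<close> and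
  \<open>t i\<close>; the generators of \<open>A\<close> are \<open>a i\<close>.  As
  \<open>t\<^sub>i\<^sup>-\<^sup>1 h t\<^sub>i = \<theta>\<^sub>i(h)\<close>, left conjugation by
  \<open>t\<^sub>i\<close> is the inverse of \<open>\<phi> i\<close>; this is why \<open>A\<close> acts on
  \<open>F\<close> through \<open>\<psi>\<close>.  It is restricted to the carrier because
  \<open>AutoGroup\<close> consists of extensional maps.
\<close>

definition "gens = carrier F <+> I"
definition "rels = hnn_relators F I H \<theta>"
definition "G = hnn_extension F I H \<theta>"
definition "j f = generator gens rels (Inl f)"
definition "t i = generator gens rels (Inr i)"

definition "A = free_group_on I"
definition "a i = generator I {} i"
definition "\<psi> i = restrict (inv_into (carrier F) (\<phi> i)) (carrier F)"
definition "\<alpha> = induced_hom I {} (AutoGroup F) \<psi>"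
definition "Q = semidirect_product F A \<alpha>"

text \<open>
  The set \<open>X\<close> indexes the edges of the quotient graph outside the spanning tree, and
  \<open>edge_label i q\<close> labels the edge from \<open>q\<close> to \<open>t\<^sub>i q\<close>.  The
  homomorphism \<open>\<tau>\<close> to the wreath product records an element of \<open>G\<close> as its image
  \<open>\<rho> g\<close> in \<open>Q\<close> together with the product \<open>cocycle g x\<close> of the
  labels met when \<open>g\<close> moves \<open>x\<close> to \<open>\<rho> g x\<close>.  Left multiplication
  by \<open>F\<close> stays at one vertex of the quotient graph, so elements of \<open>F\<close> contribute
  the trivial label.
\<close>

definition "X = {(i, C, w). i \<in> I \<and> C \<in> rcosets\<^bsub>F\<^esub> H' i \<and> C \<noteq> H' i \<and> w \<in> carrier A}"
definition "\<Phi> = free_group_on X"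
definition "edge_label i = (\<lambda>(f, w)\<in>carrier Q.
  if f \<in> H' i then \<one>\<^bsub>\<Phi>\<^esub> else generator X {} (i, H' i #>\<^bsub>F\<^esub> f, w))"
definition "W = wreath_product \<Phi> Q"
definition "\<tau> = induced_hom gens rels W
  (case_sum (\<lambda>f. (\<lambda>x\<in>carrier Q. \<one>\<^bsub>\<Phi>\<^esub>, (f, \<one>\<^bsub>A\<^esub>))) (\<lambda>i. (edge_label i, (\<one>\<^bsub>F\<^esub>, a i))))"
definition "\<rho> g = snd (\<tau> g)"
definition "cocycle g x = fst (\<tau> g) x"

text \<open>
  The map \<open>transversal\<close> is a section of \<open>\<rho>\<close>, compatible with left
  multiplication by \<open>F\<close>; it need not be a homomorphism, since \<open>t\<^sub>i\<close> conjugates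
  only \<open>H\<^sub>i\<close> in \<open>G\<close>, but all of \<open>F\<close> in \<open>Q\<close>.  Its
  failure along the edge from \<open>q\<close> to \<open>t\<^sub>i q\<close> is the Schreier generator
  \<open>schreier_gen i q\<close> of \<open>L\<close>, and \<open>\<iota>\<close> sends the label of an edge
  to the Schreier generator of that edge.
\<close>

definition "\<sigma> = induced_hom I {} G t"
definition "transversal = (\<lambda>(f, w). j f \<otimes>\<^bsub>G\<^esub> \<sigma> w)"
definition "schreier_gen i = (\<lambda>(f, w).
  inv\<^bsub>G\<^esub> transversal (\<psi> i f, a i \<otimes>\<^bsub>A\<^esub> w) \<otimes>\<^bsub>G\<^esub> t i \<otimes>\<^bsub>G\<^esub> transversal (f, w))"
definition "\<iota> = induced_hom X {} G (\<lambda>(i, C, w). schreier_gen i (SOME f. f \<in> C, w))"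

lemma G_presented: "G = presented_group gens rels"
  by (simp add: G_def hnn_extension_def gens_def rels_def)

sublocale G: group G
  by (simp add: G_presented group_presented_group)

sublocale A: group A
  by (simp add: A_def group_free_group_on)

sublocale \<Phi>: group \<Phi>
  by (simp add: \<Phi>_def group_free_group_on)

lemma j_closed [simp, intro]: "f \<in> carrier F \<Longrightarrow> j f \<in> carrier G"
  by (auto simp: j_def G_presented gens_def)

lemma t_closed [simp, intro]: "i \<in> I \<Longrightarrow> t i \<in> carrier G"
  by (auto simp: t_def G_presented gens_def)

lemma a_closed [simp, intro]: "i \<in> I \<Longrightarrow> a i \<in> carrier A"
  by (auto simp: a_def A_def free_group_on_def)

lemma H_closed: "i \<in> I \<Longrightarrow> h \<in> H i \<Longrightarrow> h \<in> carrier F"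
  using subgroup.mem_carrier[OF H] .

lemma H'_closed: "i \<in> I \<Longrightarrow> h \<in> H' i \<Longrightarrow> h \<in> carrier F"
  using subgroup.mem_carrier[OF H'] .

lemma \<theta>_closed: "i \<in> I \<Longrightarrow> h \<in> H i \<Longrightarrow> \<theta> i h \<in> H' i"
  using \<theta>_image by blast

lemma j_mult:
  assumes "f \<in> carrier F" "f' \<in> carrier F"
  shows "j (f \<otimes>\<^bsub>F\<^esub> f') = j f \<otimes>\<^bsub>G\<^esub> j f'"
proof -
  have "word_value G (generator gens rels)
      [(Inl f, True), (Inl f', True), (Inl (f \<otimes>\<^bsub>F\<^esub> f'), False)] = \<one>\<^bsub>G\<^esub>"
    unfolding G_presented using assms
    by (intro relator_value) (auto simp: rels_def hnn_relators_def gens_def)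
  then have "j f \<otimes>\<^bsub>G\<^esub> j f' \<otimes>\<^bsub>G\<^esub> inv\<^bsub>G\<^esub> j (f \<otimes>\<^bsub>F\<^esub> f') = \<one>\<^bsub>G\<^esub>"
    using assms by (simp add: j_def[symmetric] G.m_assoc)
  then show ?thesis
    using assms by (metis G.inv_equality G.inv_inv G.inv_closed G.m_closed F.m_closed j_closed)
qed

sublocale j: group_hom F G j
  by unfold_locales (auto simp: hom_def j_mult)

lemma t_conjugates:
  assumes i: "i \<in> I" and h: "h \<in> H i"
  shows "t i \<otimes>\<^bsub>G\<^esub> j (\<theta> i h) = j h \<otimes>\<^bsub>G\<^esub> t i"
proof -
  have F: "h \<in> carrier F" "\<theta> i h \<in> carrier F"
    using H_closed[OF i h] H'_closed[OF i \<theta>_closed[OF i h]] by auto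
  have "word_value G (generator gens rels)
      [(Inr i, False), (Inl h, True), (Inr i, True), (Inl (\<theta> i h), False)] = \<one>\<^bsub>G\<^esub>"
    unfolding G_presented using i h F
    by (intro relator_value) (auto simp: rels_def hnn_relators_def gens_def)
  then have "inv\<^bsub>G\<^esub> t i \<otimes>\<^bsub>G\<^esub> j h \<otimes>\<^bsub>G\<^esub> t i \<otimes>\<^bsub>G\<^esub> inv\<^bsub>G\<^esub> j (\<theta> i h) = \<one>\<^bsub>G\<^esub>"
    using i F by (simp add: j_def[symmetric] t_def[symmetric] G.m_assoc del: j.hom_inv)
  then have "inv\<^bsub>G\<^esub> t i \<otimes>\<^bsub>G\<^esub> j h \<otimes>\<^bsub>G\<^esub> t i = j (\<theta> i h)"
    using i F by (metis G.inv_equality G.inv_inv G.inv_closed G.m_closed j_closed t_closed)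
  then show ?thesis
    using i F by (metis G.inv_solve_left G.m_assoc G.inv_closed G.m_closed j_closed t_closed)
qed

lemma \<psi>_iso: "i \<in> I \<Longrightarrow> \<psi> i \<in> carrier (AutoGroup F)"
  using F.iso_set_sym[OF \<phi>[of i]]
  by (auto simp: carrier_AutoGroup \<psi>_def iso_def hom_def bij_betw_def inj_on_def)

lemma \<psi>_\<theta>: "i \<in> I \<Longrightarrow> h \<in> H i \<Longrightarrow> \<psi> i (\<theta> i h) = h"
  using \<phi>[of i] H_closed[of i h] H'_closed[OF _ \<theta>_closed, of i h]
  by (auto simp: \<psi>_def iso_def bij_betw_def simp flip: \<phi>_eq)

lemma \<psi>_H':
  assumes "i \<in> I" "h' \<in> H' i"
  shows "\<psi> i h' \<in> H i" "\<theta> i (\<psi> i h') = h'"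
proof -
  obtain h where "h \<in> H i" "h' = \<theta> i h" using assms \<theta>_image[of i] by blast
  then show "\<psi> i h' \<in> H i" "\<theta> i (\<psi> i h') = h'" using assms(1) \<psi>_\<theta> by simp_all
qed

lemma \<alpha>: "\<alpha> \<in> hom A (AutoGroup F)" "i \<in> I \<Longrightarrow> \<alpha> (a i) = \<psi> i"
  unfolding \<alpha>_def A_def a_def free_group_on_def
  using induced_hom[OF F.AutoGroup, of \<psi> I "{}"] \<psi>_iso by auto

sublocale act: group_action_by_automorphisms F A \<alpha>
  using \<alpha> by unfold_locales

sublocale Q: group Q
  unfolding Q_def by (rule act.group_semidirect_product)

lemma Q_simps [simp]:
  "carrier Q = carrier F \<times> carrier A"
  "(f, w) \<otimes>\<^bsub>Q\<^esub> (f', w') = (f \<otimes>\<^bsub>F\<^esub> \<alpha> w f', w \<otimes>\<^bsub>A\<^esub> w')"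
  "\<one>\<^bsub>Q\<^esub> = (\<one>\<^bsub>F\<^esub>, \<one>\<^bsub>A\<^esub>)"
  by (auto simp: Q_def semidirect_product_def)

sublocale W: group W
  unfolding W_def by (rule group_wreath_product[OF \<Phi>.is_group Q.is_group])

lemma W_simps:
  "carrier W = (carrier Q \<rightarrow>\<^sub>E carrier \<Phi>) \<times> carrier Q"
  "(\<beta>, q) \<otimes>\<^bsub>W\<^esub> (\<beta>', q') = (\<lambda>x\<in>carrier Q. \<beta> (q' \<otimes>\<^bsub>Q\<^esub> x) \<otimes>\<^bsub>\<Phi>\<^esub> \<beta>' x, q \<otimes>\<^bsub>Q\<^esub> q')"
  "\<one>\<^bsub>W\<^esub> = (\<lambda>x\<in>carrier Q. \<one>\<^bsub>\<Phi>\<^esub>, \<one>\<^bsub>Q\<^esub>)"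
  by (auto simp: W_def wreath_product_def)

lemma H'_coset: "i \<in> I \<Longrightarrow> f \<in> carrier F \<Longrightarrow> H' i #>\<^bsub>F\<^esub> f = H' i \<longleftrightarrow> f \<in> H' i"
  using F.coset_join1[OF _ _ H'] F.coset_join2[OF _ H'] by blast

lemma \<psi>_closed: "i \<in> I \<Longrightarrow> f \<in> carrier F \<Longrightarrow> \<psi> i f \<in> carrier F"
  using act.action_simps(1)[of "a i" f] by (simp add: \<alpha>)

lemma X_memI:
  "\<lbrakk>i \<in> I; f \<in> carrier F; f \<notin> H' i; w \<in> carrier A\<rbrakk> \<Longrightarrow> (i, H' i #>\<^bsub>F\<^esub> f, w) \<in> X"
  using H'_coset[of i f] by (auto simp: X_def RCOSETS_def)

lemma generator_\<Phi> [simp]: "x \<in> X \<Longrightarrow> generator X {} x \<in> carrier \<Phi>"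
  by (auto simp: \<Phi>_def free_group_on_def)

lemma edge_label_closed: "i \<in> I \<Longrightarrow> edge_label i \<in> carrier Q \<rightarrow>\<^sub>E carrier \<Phi>"
  by (auto simp: edge_label_def X_memI)

text \<open>
  Labels depend only on the coset \<open>H'\<^sub>i f\<close>.  This makes the relator
  \<open>t\<^sub>i\<^sup>-\<^sup>1 h t\<^sub>i = \<theta>\<^sub>i(h)\<close> hold in the wreath product, where
  the labels on its two sides are \<open>edge_label i x\<close> and \<open>edge_label i (\<theta>\<^sub>i(h)
  x)\<close>.
\<close>

lemma edge_label_invariant:
  assumes "i \<in> I" "h \<in> H' i" "f \<in> carrier F" "w \<in> carrier A"
  shows "edge_label i (h \<otimes>\<^bsub>F\<^esub> f, w) = edge_label i (f, w)"
proof -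
  have h: "h \<in> carrier F" using H'_closed assms by blast
  have "h \<otimes>\<^bsub>F\<^esub> f \<in> H' i \<longleftrightarrow> f \<in> H' i"
    using assms h by (metis F.inv_solve_left F.m_closed H' subgroup.m_closed subgroup.m_inv_closed F.l_one F.m_assoc F.l_inv F.inv_closed)
  moreover have "H' i #>\<^bsub>F\<^esub> (h \<otimes>\<^bsub>F\<^esub> f) = H' i #>\<^bsub>F\<^esub> f"
    using assms h F.coset_mult_assoc[OF subgroup.subset[OF H'], of i h f] F.coset_join2[OF h H']
    by auto
  ultimately show ?thesis using assms h by (auto simp: edge_label_def)
qed

lemma \<tau>:
  shows "\<tau> \<in> hom G W"
    and "f \<in> carrier F \<Longrightarrow> \<tau> (j f) = (\<lambda>x\<in>carrier Q. \<one>\<^bsub>\<Phi>\<^esub>, (f, \<one>\<^bsub>A\<^esub>))"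
    and "i \<in> I \<Longrightarrow> \<tau> (t i) = (edge_label i, (\<one>\<^bsub>F\<^esub>, a i))"
proof -
  define u where
    "u = case_sum (\<lambda>f. (\<lambda>x\<in>carrier Q. \<one>\<^bsub>\<Phi>\<^esub>, (f, \<one>\<^bsub>A\<^esub>))) (\<lambda>i. (edge_label i, (\<one>\<^bsub>F\<^esub>, a i)))"
  have u_F: "u (Inl f) = (\<lambda>x\<in>carrier Q. \<one>\<^bsub>\<Phi>\<^esub>, (f, \<one>\<^bsub>A\<^esub>))" for f by (simp add: u_def)
  have u_t: "u (Inr i) = (edge_label i, (\<one>\<^bsub>F\<^esub>, a i))" for i by (simp add: u_def)
  have u_F_closed: "u (Inl f) \<in> carrier W" if "f \<in> carrier F" for f
    using that by (simp add: u_F W_simps)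
  have u_t_closed: "u (Inr i) \<in> carrier W" if "i \<in> I" for i
    using that edge_label_closed[OF that] by (simp add: u_t W_simps)
  have u: "u \<in> gens \<rightarrow> carrier W"
    by (auto simp: gens_def u_F_closed u_t_closed)
  have u_mult: "u (Inl f) \<otimes>\<^bsub>W\<^esub> u (Inl f') = u (Inl (f \<otimes>\<^bsub>F\<^esub> f'))"
    if "f \<in> carrier F" "f' \<in> carrier F" for f f'
    using that by (auto simp: u_F W_simps intro!: restrict_ext)
  have u_conj: "u (Inl h) \<otimes>\<^bsub>W\<^esub> u (Inr i) = u (Inr i) \<otimes>\<^bsub>W\<^esub> u (Inl (\<theta> i h))"
    if ih: "i \<in> I" "h \<in> H i" for i h
  proof -
    have F: "h \<in> carrier F" "\<theta> i h \<in> H' i" "\<theta> i h \<in> carrier F" "\<psi> i (\<theta> i h) = h"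
      using H_closed H'_closed \<theta>_closed ih \<psi>_\<theta> by auto
    show ?thesis
      using F ih edge_label_closed[OF ih(1)]
      by (auto simp: u_F u_t W_simps \<alpha> \<psi>_closed edge_label_invariant PiE_iff intro!: restrict_ext)
  qed
  have R: "word_value W u r = \<one>\<^bsub>W\<^esub>" if r: "r \<in> rels" "r \<in> words gens" for r
  proof -
    consider (F) f f' where "f \<in> carrier F" "f' \<in> carrier F"
        "r = [(Inl f, True), (Inl f', True), (Inl (f \<otimes>\<^bsub>F\<^esub> f'), False)]"
      | (t) i h where "i \<in> I" "h \<in> H i"
        "r = [(Inr i, False), (Inl h, True), (Inr i, True), (Inl (\<theta> i h), False)]"
      using r(1) by (auto simp: rels_def hnn_relators_def)
    then show ?thesis
    proof cases
      case F
      then show ?thesis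
        by (simp add: u_F_closed u_mult flip: W.m_assoc)
    next
      case t
      have "\<theta> i h \<in> carrier F" "h \<in> carrier F"
        using H_closed H'_closed \<theta>_closed t by auto
      then have closed: "u (Inr i) \<in> carrier W" "u (Inl h) \<in> carrier W" "u (Inl (\<theta> i h)) \<in> carrier W"
        using t by (simp_all add: u_t_closed u_F_closed)
      have "word_value W u r =
          inv\<^bsub>W\<^esub> u (Inr i) \<otimes>\<^bsub>W\<^esub> (u (Inl h) \<otimes>\<^bsub>W\<^esub> u (Inr i)) \<otimes>\<^bsub>W\<^esub> inv\<^bsub>W\<^esub> u (Inl (\<theta> i h))"
        using closed t(3) by (simp add: W.m_assoc)
      also have "\<dots> = \<one>\<^bsub>W\<^esub>"
        unfolding u_conj[OF t(1,2)] using closed by (simp flip: W.m_assoc)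
      finally show ?thesis .
    qed
  qed
  have \<tau>_eq: "\<tau> = induced_hom gens rels W u" by (simp add: \<tau>_def u_def)
  note ind = induced_hom[of W u gens rels, OF W.is_group u, folded \<tau>_eq]
  show "\<tau> \<in> hom G W" unfolding G_presented by (rule ind(1)) (rule R)
  show "\<tau> (j f) = (\<lambda>x\<in>carrier Q. \<one>\<^bsub>\<Phi>\<^esub>, (f, \<one>\<^bsub>A\<^esub>))" if "f \<in> carrier F"
  proof -
    have "\<tau> (generator gens rels (Inl f)) = u (Inl f)"
      using that by (intro ind(2)) (auto simp: gens_def intro: R)
    then show ?thesis by (simp add: j_def u_F)
  qed
  show "\<tau> (t i) = (edge_label i, (\<one>\<^bsub>F\<^esub>, a i))" if "i \<in> I"
  proof -
    have "\<tau> (generator gens rels (Inr i)) = u (Inr i)"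
      using that by (intro ind(2)) (auto simp: gens_def intro: R)
    then show ?thesis by (simp add: t_def u_t)
  qed
qed

section \<open>The kernel of the map to the semidirect product is free\<close>

sublocale \<tau>: group_hom G W \<tau>
  using \<tau>(1) by unfold_locales

lemma \<tau>_mem: "g \<in> carrier G \<Longrightarrow> \<tau> g \<in> (carrier Q \<rightarrow>\<^sub>E carrier \<Phi>) \<times> carrier Q"
  using \<tau>.hom_closed[of g] by (simp add: W_simps)

lemma \<tau>_mult: "g \<in> carrier G \<Longrightarrow> g' \<in> carrier G \<Longrightarrow>
    \<tau> (g \<otimes>\<^bsub>G\<^esub> g') =
      (\<lambda>x\<in>carrier Q. cocycle g (\<rho> g' \<otimes>\<^bsub>Q\<^esub> x) \<otimes>\<^bsub>\<Phi>\<^esub> cocycle g' x, \<rho> g \<otimes>\<^bsub>Q\<^esub> \<rho> g')"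
  using \<tau>.hom_mult[of g g'] W_simps(2)[of "cocycle g" "\<rho> g" "cocycle g'" "\<rho> g'"] \<tau>_mem[of g] \<tau>_mem[of g']
  unfolding cocycle_def \<rho>_def by (simp del: Q_simps)

sublocale \<rho>: group_hom G Q \<rho>
proof unfold_locales
  show "\<rho> \<in> hom G Q"
  proof (rule homI)
    show "\<rho> g \<in> carrier Q" if "g \<in> carrier G" for g
      using \<tau>_mem[OF that] by (auto simp: \<rho>_def)
    show "\<rho> (g \<otimes>\<^bsub>G\<^esub> g') = \<rho> g \<otimes>\<^bsub>Q\<^esub> \<rho> g'" if "g \<in> carrier G" "g' \<in> carrier G" for g g'
      using \<tau>_mult[OF that] by (simp add: \<rho>_def)
  qed
qed

lemma cocycle_closed: "g \<in> carrier G \<Longrightarrow> x \<in> carrier Q \<Longrightarrow> cocycle g x \<in> carrier \<Phi>"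
  using \<tau>_mem[of g] by (auto simp: cocycle_def)

lemma cocycle_mult:
  "\<lbrakk>g \<in> carrier G; g' \<in> carrier G; x \<in> carrier Q\<rbrakk> \<Longrightarrow>
    cocycle (g \<otimes>\<^bsub>G\<^esub> g') x = cocycle g (\<rho> g' \<otimes>\<^bsub>Q\<^esub> x) \<otimes>\<^bsub>\<Phi>\<^esub> cocycle g' x"
  using \<tau>_mult[of g g'] by (simp add: cocycle_def del: Q_simps)

lemma cocycle_one: "x \<in> carrier Q \<Longrightarrow> cocycle \<one>\<^bsub>G\<^esub> x = \<one>\<^bsub>\<Phi>\<^esub>"
  using \<tau>.hom_one by (simp add: cocycle_def W_simps del: Q_simps)

lemma cocycle_inv:
  assumes "g \<in> carrier G" "x \<in> carrier Q"
  shows "cocycle (inv\<^bsub>G\<^esub> g) x = inv\<^bsub>\<Phi>\<^esub> cocycle g (inv\<^bsub>Q\<^esub> \<rho> g \<otimes>\<^bsub>Q\<^esub> x)"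
proof -
  let ?y = "inv\<^bsub>Q\<^esub> \<rho> g \<otimes>\<^bsub>Q\<^esub> x"
  have y: "?y \<in> carrier Q" using assms by (simp del: Q_simps \<rho>.hom_inv)
  have "\<one>\<^bsub>\<Phi>\<^esub> = cocycle (inv\<^bsub>G\<^esub> g \<otimes>\<^bsub>G\<^esub> g) ?y"
    using assms y by (simp add: cocycle_one del: Q_simps)
  also have "\<dots> = cocycle (inv\<^bsub>G\<^esub> g) (\<rho> g \<otimes>\<^bsub>Q\<^esub> ?y) \<otimes>\<^bsub>\<Phi>\<^esub> cocycle g ?y"
    using assms y by (intro cocycle_mult) auto
  also have "\<rho> g \<otimes>\<^bsub>Q\<^esub> ?y = x"
    using assms by (simp add: Q.m_assoc[symmetric] del: Q_simps \<rho>.hom_inv)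
  finally have "cocycle (inv\<^bsub>G\<^esub> g) x \<otimes>\<^bsub>\<Phi>\<^esub> cocycle g ?y = \<one>\<^bsub>\<Phi>\<^esub>" by simp
  then show ?thesis
    using assms y by (metis \<Phi>.inv_equality \<Phi>.inv_inv cocycle_closed G.inv_closed)
qed

lemma \<rho>_j [simp]: "f \<in> carrier F \<Longrightarrow> \<rho> (j f) = (f, \<one>\<^bsub>A\<^esub>)"
  and \<rho>_t [simp]: "i \<in> I \<Longrightarrow> \<rho> (t i) = (\<one>\<^bsub>F\<^esub>, a i)"
  and cocycle_j: "f \<in> carrier F \<Longrightarrow> x \<in> carrier Q \<Longrightarrow> cocycle (j f) x = \<one>\<^bsub>\<Phi>\<^esub>"
  and cocycle_t: "i \<in> I \<Longrightarrow> cocycle (t i) x = edge_label i x"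
  by (simp_all add: \<rho>_def cocycle_def \<tau> del: Q_simps)

lemma \<sigma>: "\<sigma> \<in> hom A G" "i \<in> I \<Longrightarrow> \<sigma> (a i) = t i"
  unfolding \<sigma>_def A_def a_def free_group_on_def
  using induced_hom[OF G.is_group, of t I "{}"] by auto

sublocale \<sigma>: group_hom A G \<sigma>
  using \<sigma>(1) by unfold_locales

lemma transversal_closed: "q \<in> carrier Q \<Longrightarrow> transversal q \<in> carrier G"
  by (auto simp: transversal_def)

lemma \<psi>_mult: "i \<in> I \<Longrightarrow> f \<in> carrier F \<Longrightarrow> f' \<in> carrier F \<Longrightarrow>
    \<psi> i (f \<otimes>\<^bsub>F\<^esub> f') = \<psi> i f \<otimes>\<^bsub>F\<^esub> \<psi> i f'"
  using act.action_simps(2)[of "a i" f f'] by (simp add: \<alpha>)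

lemma t_j_H':
  assumes "i \<in> I" "h' \<in> H' i"
  shows "t i \<otimes>\<^bsub>G\<^esub> j h' = j (\<psi> i h') \<otimes>\<^bsub>G\<^esub> t i"
  using t_conjugates[OF assms(1) \<psi>_H'(1)[OF assms]] \<psi>_H'(2)[OF assms] by simp

lemma transversal_j_mult:
  assumes "f \<in> carrier F" "f' \<in> carrier F" "w \<in> carrier A"
  shows "transversal (f \<otimes>\<^bsub>F\<^esub> f', w) = j f \<otimes>\<^bsub>G\<^esub> transversal (f', w)"
  using assms by (simp add: transversal_def G.m_assoc)

lemma stable_mult_transversal:
  assumes "i \<in> I" "q \<in> carrier Q"
  shows "t i \<otimes>\<^bsub>G\<^esub> transversal q = transversal (\<rho> (t i) \<otimes>\<^bsub>Q\<^esub> q) \<otimes>\<^bsub>G\<^esub> schreier_gen i q"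
proof -
  obtain f w where q: "q = (f, w)" "f \<in> carrier F" "w \<in> carrier A" using assms by auto
  have *: "transversal (\<psi> i f, a i \<otimes>\<^bsub>A\<^esub> w) \<in> carrier G"
    using q assms by (intro transversal_closed) (auto simp: \<psi>_closed)
  show ?thesis
    using q assms * transversal_closed[of q]
    by (simp add: schreier_gen_def \<alpha> \<psi>_closed G.m_assoc[symmetric])
qed

lemma schreier_gen_closed: "i \<in> I \<Longrightarrow> q \<in> carrier Q \<Longrightarrow> schreier_gen i q \<in> carrier G"
  by (auto simp: schreier_gen_def transversal_closed \<psi>_closed)

text \<open>
  The Schreier generators have the same invariance as the labels, now because of the HNN relation in
  \<open>G\<close>: \<open>t\<^sub>i h = \<psi>\<^sub>i(h) t\<^sub>i\<close> for \<open>h\<close> in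
  \<open>H'\<^sub>i\<close>, so \<open>\<psi>\<^sub>i(h)\<close> cancels against its inverse.  Hence
  \<open>\<iota>\<close> below is consistent with every choice of coset representatives.
\<close>

lemma schreier_gen_invariant:
  assumes i: "i \<in> I" and h: "h \<in> H' i" and f: "f \<in> carrier F" and w: "w \<in> carrier A"
  shows "schreier_gen i (h \<otimes>\<^bsub>F\<^esub> f, w) = schreier_gen i (f, w)"
proof -
  have F: "h \<in> carrier F" "\<psi> i h \<in> carrier F" "\<psi> i f \<in> carrier F" "a i \<otimes>\<^bsub>A\<^esub> w \<in> carrier A"
    using H'_closed[OF i h] i f w \<psi>_closed by auto
  define u where "u = transversal (\<psi> i f, a i \<otimes>\<^bsub>A\<^esub> w)"
  define v where "v = transversal (f, w)"
  have uv: "u \<in> carrier G" "v \<in> carrier G"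
    using F f w by (auto simp: u_def v_def intro!: transversal_closed)
  have "schreier_gen i (h \<otimes>\<^bsub>F\<^esub> f, w) =
      inv\<^bsub>G\<^esub> (j (\<psi> i h) \<otimes>\<^bsub>G\<^esub> u) \<otimes>\<^bsub>G\<^esub> t i \<otimes>\<^bsub>G\<^esub> (j h \<otimes>\<^bsub>G\<^esub> v)"
    using i F f w by (simp add: schreier_gen_def \<psi>_mult transversal_j_mult u_def v_def)
  also have "\<dots> = inv\<^bsub>G\<^esub> u \<otimes>\<^bsub>G\<^esub> (inv\<^bsub>G\<^esub> j (\<psi> i h) \<otimes>\<^bsub>G\<^esub> (t i \<otimes>\<^bsub>G\<^esub> j h)) \<otimes>\<^bsub>G\<^esub> v"
    using i F uv by (simp add: G.inv_mult_group G.m_assoc del: j.hom_inv)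
  also have "inv\<^bsub>G\<^esub> j (\<psi> i h) \<otimes>\<^bsub>G\<^esub> (t i \<otimes>\<^bsub>G\<^esub> j h) = t i"
    using i F by (simp add: t_j_H'[OF i h] G.m_assoc[symmetric] del: j.hom_inv)
  finally show ?thesis
    using i by (simp add: schreier_gen_def u_def v_def)
qed

lemma schreier_gen_H':
  assumes i: "i \<in> I" and h: "h \<in> H' i" and w: "w \<in> carrier A"
  shows "schreier_gen i (h, w) = \<one>\<^bsub>G\<^esub>"
proof -
  have "\<psi> i \<one>\<^bsub>F\<^esub> = \<one>\<^bsub>F\<^esub>"
    using act.action_simps(5)[of "a i"] i by (simp add: \<alpha>)
  then have "schreier_gen i (\<one>\<^bsub>F\<^esub>, w) = \<one>\<^bsub>G\<^esub>"
    using i w by (simp add: schreier_gen_def transversal_def \<sigma> G.m_assoc del: G.inv_mult_group)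
  then show ?thesis
    using schreier_gen_invariant[OF i h F.one_closed w] H'_closed[OF i h] by simp
qed

lemma schreier_gen_coset_rep:
  assumes "i \<in> I" "f \<in> carrier F" "w \<in> carrier A"
  shows "schreier_gen i (SOME f'. f' \<in> H' i #>\<^bsub>F\<^esub> f, w) = schreier_gen i (f, w)"
proof -
  have "f \<in> H' i #>\<^bsub>F\<^esub> f" using F.rcos_self[OF assms(2) H'[OF assms(1)]] .
  then have "(SOME f'. f' \<in> H' i #>\<^bsub>F\<^esub> f) \<in> H' i #>\<^bsub>F\<^esub> f" by (rule someI)
  then obtain h where "h \<in> H' i" "(SOME f'. f' \<in> H' i #>\<^bsub>F\<^esub> f) = h \<otimes>\<^bsub>F\<^esub> f"
    unfolding r_coset_def by blast
  then show ?thesis using schreier_gen_invariant assms by simp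
qed

lemma \<iota>:
  shows "\<iota> \<in> hom \<Phi> G"
    and "\<lbrakk>i \<in> I; q \<in> carrier Q\<rbrakk> \<Longrightarrow> \<iota> (edge_label i q) = schreier_gen i q"
proof -
  let ?u = "\<lambda>(i, C, w). schreier_gen i (SOME f. f \<in> C, w)"
  have u: "?u \<in> X \<rightarrow> carrier G"
    by (auto simp: X_def RCOSETS_def schreier_gen_coset_rep schreier_gen_closed)
  note ind = induced_hom[OF G.is_group u, of "{}", folded \<iota>_def, folded free_group_on_def, folded \<Phi>_def]
  show hom: "\<iota> \<in> hom \<Phi> G" by (rule ind) auto
  show "\<iota> (edge_label i q) = schreier_gen i q" if i: "i \<in> I" and q': "q \<in> carrier Q"
  proof -
    obtain f w where q: "q = (f, w)" "f \<in> carrier F" "w \<in> carrier A" using q' by auto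
    show ?thesis
    proof (cases "f \<in> H' i")
      case True
      then show ?thesis
        using q i hom_one[OF hom \<Phi>.is_group G.is_group] by (simp add: edge_label_def schreier_gen_H')
    next
      case False
      then show ?thesis
        using q i ind(2)[OF _ X_memI[of i f w]] by (simp add: edge_label_def schreier_gen_coset_rep)
    qed
  qed
qed

sublocale \<iota>: group_hom \<Phi> G \<iota>
  using \<iota>(1) by unfold_locales

lemma G_generated:
  assumes "subgroup S G" "\<And>f. f \<in> carrier F \<Longrightarrow> j f \<in> S" "\<And>i. i \<in> I \<Longrightarrow> t i \<in> S"
  shows "carrier G \<subseteq> S"
  unfolding G_presented
proof (rule presented_group_generated)
  show "subgroup S (presented_group gens rels)" using assms(1) by (simp add: G_presented)
  show "generator gens rels x \<in> S" if "x \<in> gens" for x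
    using that assms(2,3) by (auto simp: gens_def j_def t_def)
qed

lemma A_generated:
  assumes "subgroup S A" "\<And>i. i \<in> I \<Longrightarrow> a i \<in> S"
  shows "carrier A \<subseteq> S"
  using assms presented_group_generated[of S I "{}"] by (auto simp: A_def a_def free_group_on_def)

text \<open>
  For a generator \<open>g\<close> this is the definition of the Schreier generators, and both sides compose
  by the cocycle rule.  For \<open>q = 1\<close> and \<open>g\<close> in \<open>L\<close> it reads \<open>g =
  \<iota> (cocycle g 1)\<close>.
\<close>

lemma mult_transversal:
  assumes "g \<in> carrier G" "q \<in> carrier Q"
  shows "g \<otimes>\<^bsub>G\<^esub> transversal q = transversal (\<rho> g \<otimes>\<^bsub>Q\<^esub> q) \<otimes>\<^bsub>G\<^esub> \<iota> (cocycle g q)"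
proof -
  define S where "S = {g \<in> carrier G. \<forall>q\<in>carrier Q.
    g \<otimes>\<^bsub>G\<^esub> transversal q = transversal (\<rho> g \<otimes>\<^bsub>Q\<^esub> q) \<otimes>\<^bsub>G\<^esub> \<iota> (cocycle g q)}"
  have SD: "g \<in> carrier G" "q \<in> carrier Q \<Longrightarrow>
      g \<otimes>\<^bsub>G\<^esub> transversal q = transversal (\<rho> g \<otimes>\<^bsub>Q\<^esub> q) \<otimes>\<^bsub>G\<^esub> \<iota> (cocycle g q)" if "g \<in> S" for g q
    using that by (auto simp: S_def)
  have "subgroup S G"
  proof
    show "S \<subseteq> carrier G" by (auto simp: S_def)
    show "\<one>\<^bsub>G\<^esub> \<in> S" using transversal_closed by (auto simp: S_def cocycle_one simp del: Q_simps)
  next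
    fix g g' assume S: "g \<in> S" "g' \<in> S"
    note g = SD(1)[OF S(1)] and g' = SD(1)[OF S(2)]
    have "g \<otimes>\<^bsub>G\<^esub> g' \<otimes>\<^bsub>G\<^esub> transversal q = transversal (\<rho> (g \<otimes>\<^bsub>G\<^esub> g') \<otimes>\<^bsub>Q\<^esub> q) \<otimes>\<^bsub>G\<^esub> \<iota> (cocycle (g \<otimes>\<^bsub>G\<^esub> g') q)"
      if q: "q \<in> carrier Q" for q
    proof -
      let ?q = "\<rho> g' \<otimes>\<^bsub>Q\<^esub> q"
      have q': "?q \<in> carrier Q" "\<rho> g \<otimes>\<^bsub>Q\<^esub> ?q \<in> carrier Q"
        using g g' q by (simp_all del: Q_simps)
      have "g \<otimes>\<^bsub>G\<^esub> g' \<otimes>\<^bsub>G\<^esub> transversal q = g \<otimes>\<^bsub>G\<^esub> transversal ?q \<otimes>\<^bsub>G\<^esub> \<iota> (cocycle g' q)"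
        using SD(2)[OF S(2) q] g g' q q' by (simp add: G.m_assoc transversal_closed cocycle_closed del: Q_simps)
      also have "\<dots> = transversal (\<rho> g \<otimes>\<^bsub>Q\<^esub> ?q) \<otimes>\<^bsub>G\<^esub> \<iota> (cocycle g ?q \<otimes>\<^bsub>\<Phi>\<^esub> cocycle g' q)"
        using SD(2)[OF S(1) q'(1)] g g' q q' by (simp add: G.m_assoc transversal_closed cocycle_closed del: Q_simps)
      finally show ?thesis
        using g g' q by (simp add: cocycle_mult Q.m_assoc del: Q_simps)
    qed
    then show "g \<otimes>\<^bsub>G\<^esub> g' \<in> S" using g g' by (simp add: S_def del: Q_simps)
  next
    fix g assume S: "g \<in> S"
    note g = SD(1)[OF S]
    have "inv\<^bsub>G\<^esub> g \<otimes>\<^bsub>G\<^esub> transversal q = transversal (\<rho> (inv\<^bsub>G\<^esub> g) \<otimes>\<^bsub>Q\<^esub> q) \<otimes>\<^bsub>G\<^esub> \<iota> (cocycle (inv\<^bsub>G\<^esub> g) q)"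
      if q: "q \<in> carrier Q" for q
    proof -
      let ?q = "inv\<^bsub>Q\<^esub> \<rho> g \<otimes>\<^bsub>Q\<^esub> q"
      have q': "?q \<in> carrier Q" "\<rho> g \<otimes>\<^bsub>Q\<^esub> ?q = q"
        using g q by (simp_all add: Q.m_assoc[symmetric] del: Q_simps \<rho>.hom_inv)
      have k: "\<iota> (cocycle g ?q) \<in> carrier G" "transversal ?q \<in> carrier G" "transversal q \<in> carrier G"
        using g q q' by (simp_all add: transversal_closed cocycle_closed del: Q_simps \<rho>.hom_inv)
      have "g \<otimes>\<^bsub>G\<^esub> transversal ?q = transversal q \<otimes>\<^bsub>G\<^esub> \<iota> (cocycle g ?q)"
        using SD(2)[OF S q'(1)] q'(2) by simp
      then have "g \<otimes>\<^bsub>G\<^esub> (transversal ?q \<otimes>\<^bsub>G\<^esub> inv\<^bsub>G\<^esub> \<iota> (cocycle g ?q)) = transversal q"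
        using g k by (simp add: G.m_assoc[symmetric] G.inv_solve_right)
          (simp add: G.m_assoc del: \<iota>.hom_inv)
      then have "inv\<^bsub>G\<^esub> g \<otimes>\<^bsub>G\<^esub> transversal q = transversal ?q \<otimes>\<^bsub>G\<^esub> inv\<^bsub>G\<^esub> \<iota> (cocycle g ?q)"
        using g k by (metis G.inv_solve_left G.inv_closed G.m_closed G.inv_inv)
      then show ?thesis
        using g q q' by (simp add: cocycle_inv cocycle_closed del: Q_simps)
    qed
    then show "inv\<^bsub>G\<^esub> g \<in> S" using g by (simp add: S_def del: Q_simps \<rho>.hom_inv)
  qed
  moreover have "j f \<in> S" if "f \<in> carrier F" for f
    using that by (auto simp: S_def cocycle_j transversal_j_mult[symmetric] transversal_closed)
  moreover have "t i \<in> S" if "i \<in> I" for i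
    using that stable_mult_transversal[OF that] by (simp add: S_def cocycle_t \<iota> del: Q_simps \<rho>_t)
  ultimately have "carrier G \<subseteq> S" by (rule G_generated)
  then show ?thesis using SD(2) assms by blast
qed

lemma edge_label_base: "i \<in> I \<Longrightarrow> w \<in> carrier A \<Longrightarrow> edge_label i (\<one>\<^bsub>F\<^esub>, w) = \<one>\<^bsub>\<Phi>\<^esub>"
  using subgroup.one_closed[OF H', of i] by (simp add: edge_label_def)

text \<open>
  Words in the stable letters, started at the vertices \<open>(1, w)\<close>, run along the spanning tree,
  whose edges carry the trivial label.
\<close>

lemma stable_words:
  assumes "w \<in> carrier A"
  shows "\<rho> (\<sigma> w) = (\<one>\<^bsub>F\<^esub>, w)" and "w' \<in> carrier A \<Longrightarrow> cocycle (\<sigma> w) (\<one>\<^bsub>F\<^esub>, w') = \<one>\<^bsub>\<Phi>\<^esub>"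
proof -
  define S where "S = {w \<in> carrier A. \<rho> (\<sigma> w) = (\<one>\<^bsub>F\<^esub>, w) \<and>
    (\<forall>w'\<in>carrier A. cocycle (\<sigma> w) (\<one>\<^bsub>F\<^esub>, w') = \<one>\<^bsub>\<Phi>\<^esub>)}"
  have inv_Q: "inv\<^bsub>Q\<^esub> (\<one>\<^bsub>F\<^esub>, w) = (\<one>\<^bsub>F\<^esub>, inv\<^bsub>A\<^esub> w)" if "w \<in> carrier A" for w
    using that by (intro Q.inv_equality) auto
  have "subgroup S A"
  proof
    show "\<one>\<^bsub>A\<^esub> \<in> S" by (auto simp: S_def cocycle_one)
  next
    fix v w assume "v \<in> S" "w \<in> S"
    then show "v \<otimes>\<^bsub>A\<^esub> w \<in> S" by (auto simp: S_def cocycle_mult)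
  next
    fix w assume "w \<in> S"
    then have w: "w \<in> carrier A" "\<rho> (\<sigma> w) = (\<one>\<^bsub>F\<^esub>, w)"
        "\<And>w'. w' \<in> carrier A \<Longrightarrow> cocycle (\<sigma> w) (\<one>\<^bsub>F\<^esub>, w') = \<one>\<^bsub>\<Phi>\<^esub>" by (auto simp: S_def)
    then show "inv\<^bsub>A\<^esub> w \<in> S"
      using cocycle_inv[of "\<sigma> w"] by (auto simp: S_def inv_Q simp del: \<sigma>.hom_inv simp add: \<sigma>.hom_inv)
  qed (auto simp: S_def)
  moreover have "a i \<in> S" if "i \<in> I" for i
    using that by (simp add: S_def \<sigma> cocycle_t edge_label_base)
  ultimately have "carrier A \<subseteq> S" by (rule A_generated)
  then show "\<rho> (\<sigma> w) = (\<one>\<^bsub>F\<^esub>, w)" and "w' \<in> carrier A \<Longrightarrow> cocycle (\<sigma> w) (\<one>\<^bsub>F\<^esub>, w') = \<one>\<^bsub>\<Phi>\<^esub>"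
    using assms by (auto simp: S_def)
qed

lemma section_transversal:
  assumes "q \<in> carrier Q"
  shows "\<rho> (transversal q) = q" and "cocycle (transversal q) \<one>\<^bsub>Q\<^esub> = \<one>\<^bsub>\<Phi>\<^esub>"
  using assms by (auto simp: transversal_def stable_words cocycle_mult cocycle_j)

lemma \<rho>_surj: "\<rho> ` carrier G = carrier Q"
proof
  show "carrier Q \<subseteq> \<rho> ` carrier G"
  proof
    fix q assume "q \<in> carrier Q"
    then show "q \<in> \<rho> ` carrier G"
      using section_transversal(1) transversal_closed by (intro image_eqI[of _ \<rho> "transversal q"]) simp_all
  qed
  show "\<rho> ` carrier G \<subseteq> carrier Q" using \<rho>.hom_closed by blast
qed

definition "L = kernel G Q \<rho>"

lemma L_subgroup: "subgroup L G"
  unfolding L_def by (rule \<rho>.subgroup_kernel)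

text \<open>
  Injectivity is \<open>mult_transversal\<close> at \<open>q = 1\<close>.  For surjectivity the generator
  \<open>(i, H'\<^sub>i f, w)\<close> is the value at the Schreier generator \<open>y\<close> of \<open>q =
  (f, w)\<close>: in \<open>t\<^sub>i s(q) = s(t\<^sub>i q) y\<close>, where \<open>s\<close> is the
  transversal, the paths \<open>s(q)\<close> and \<open>s(t\<^sub>i q)\<close> have trivial labels, so that
  \<open>y\<close> has the label of the edge at \<open>q\<close>.
\<close>

lemma cocycle_iso: "(\<lambda>g. cocycle g \<one>\<^bsub>Q\<^esub>) \<in> iso (G\<lparr>carrier := L\<rparr>) \<Phi>"
proof -
  let ?L = "G\<lparr>carrier := L\<rparr>" and ?c = "\<lambda>g. cocycle g \<one>\<^bsub>Q\<^esub>"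
  have L: "g \<in> L \<longleftrightarrow> g \<in> carrier G \<and> \<rho> g = \<one>\<^bsub>Q\<^esub>" for g by (auto simp: L_def kernel_def)
  have hom: "?c \<in> hom ?L \<Phi>"
    by (rule homI) (auto simp: L cocycle_closed cocycle_mult simp del: Q_simps)
  interpret eval_one: group_hom ?L \<Phi> ?c
    using hom \<Phi>.is_group G.subgroup_imp_group[OF L_subgroup]
    by (simp add: group_hom_def group_hom_axioms_def)
  have s1: "transversal \<one>\<^bsub>Q\<^esub> = \<one>\<^bsub>G\<^esub>" by (simp add: transversal_def)
  have "g = \<one>\<^bsub>G\<^esub>" if "g \<in> L" "?c g = \<one>\<^bsub>\<Phi>\<^esub>" for g
    using mult_transversal[of g "\<one>\<^bsub>Q\<^esub>"] that s1 by (simp add: L del: Q_simps)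
  moreover have "carrier \<Phi> \<subseteq> ?c ` L"
  proof -
    have "generator X {} x \<in> ?c ` L" if x: "x \<in> X" for x
    proof -
      obtain i f w where x: "x = (i, H' i #>\<^bsub>F\<^esub> f, w)" "i \<in> I" "f \<in> carrier F" "w \<in> carrier A"
          "H' i #>\<^bsub>F\<^esub> f \<noteq> H' i"
        using x by (auto simp: X_def RCOSETS_def)
      let ?q = "(f, w)"
      let ?p = "\<rho> (t i) \<otimes>\<^bsub>Q\<^esub> ?q" and ?y = "schreier_gen i ?q"
      have q: "?q \<in> carrier Q" "\<rho> (t i) \<in> carrier Q" "t i \<in> carrier G"
        using x by auto
      then have "?p \<in> carrier Q" by (intro Q.m_closed)
      with q have q: "?q \<in> carrier Q" "?p \<in> carrier Q" "\<rho> (t i) \<in> carrier Q" "t i \<in> carrier G"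
          "?y \<in> carrier G" "transversal ?p \<in> carrier G" "transversal ?q \<in> carrier G"
        using x transversal_closed schreier_gen_closed by blast+
      have eq: "t i \<otimes>\<^bsub>G\<^esub> transversal ?q = transversal ?p \<otimes>\<^bsub>G\<^esub> ?y" using stable_mult_transversal x q by blast
      have "?p = ?p \<otimes>\<^bsub>Q\<^esub> \<rho> ?y"
        using arg_cong[OF eq, of \<rho>] q by (simp add: section_transversal del: Q_simps \<rho>_t)
      then have \<rho>y: "\<rho> ?y = \<one>\<^bsub>Q\<^esub>"
        using Q.l_cancel_one'[OF q(2) \<rho>.hom_closed[OF q(5)]] by simp
      have "cocycle (t i) ?q = cocycle (transversal ?p) \<one>\<^bsub>Q\<^esub> \<otimes>\<^bsub>\<Phi>\<^esub> ?c ?y"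
        using arg_cong[OF eq, of ?c] q
        by (simp add: section_transversal cocycle_mult cocycle_closed \<rho>y del: Q_simps \<rho>_t)
      then have "?c ?y = generator X {} x"
        using x q H'_coset[of i f] by (simp add: section_transversal cocycle_closed cocycle_t edge_label_def del: Q_simps)
      moreover have "?y \<in> L" using \<rho>y q by (simp add: L)
      ultimately show ?thesis by blast
    qed
    moreover have "subgroup (?c ` L) \<Phi>" using eval_one.img_is_subgroup by simp
    ultimately show ?thesis
      using presented_group_generated[of "?c ` L" X "{}"] by (simp add: \<Phi>_def free_group_on_def)
  qed
  ultimately show ?thesis by (simp add: eval_one.iso_iff del: Q_simps)
qed

lemma L_free: "is_free (G\<lparr>carrier := L\<rparr>)"
proof -
  have gL: "group (G\<lparr>carrier := L\<rparr>)" by (rule G.subgroup_imp_group[OF L_subgroup])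
  have "G\<lparr>carrier := L\<rparr> \<cong> \<Phi>" using cocycle_iso by (auto simp: is_iso_def)
  from group.iso_sym[OF gL this] show ?thesis
    by (intro is_freeI[OF gL, of X]) (simp add: \<Phi>_def)
qed

section \<open>The poly-free series\<close>

definition "base_preimage B = {g \<in> carrier G. \<rho> g \<in> B \<times> {\<one>\<^bsub>A\<^esub>}}"

lemma \<rho>_prod:
  assumes "g \<in> carrier G" "g' \<in> carrier G" "snd (\<rho> g) = \<one>\<^bsub>A\<^esub>"
  shows "fst (\<rho> (g \<otimes>\<^bsub>G\<^esub> g')) = fst (\<rho> g) \<otimes>\<^bsub>F\<^esub> fst (\<rho> g')"
proof -
  obtain f w f' w' where "\<rho> g = (f, w)" "f \<in> carrier F" "\<rho> g' = (f', w')" "f' \<in> carrier F"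
    using \<rho>.hom_closed[OF assms(1)] \<rho>.hom_closed[OF assms(2)] by (cases "\<rho> g"; cases "\<rho> g'") simp
  then show ?thesis using assms by simp
qed

lemma \<rho>_snd: "snd \<circ> \<rho> \<in> hom G A"
proof (rule homI)
  show "(snd \<circ> \<rho>) g \<in> carrier A" if "g \<in> carrier G" for g
    using \<rho>.hom_closed[OF that] by auto
  show "(snd \<circ> \<rho>) (g \<otimes>\<^bsub>G\<^esub> g') = (snd \<circ> \<rho>) g \<otimes>\<^bsub>A\<^esub> (snd \<circ> \<rho>) g'"
    if "g \<in> carrier G" "g' \<in> carrier G" for g g'
    using that \<rho>.hom_closed[of g] \<rho>.hom_closed[of g']
    by (cases "\<rho> g"; cases "\<rho> g'") (auto simp del: \<rho>.hom_closed)
qed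

sublocale \<pi>: group_hom G A "snd \<circ> \<rho>"
  using \<rho>_snd by unfold_locales

lemma base_preimage_one: "base_preimage {\<one>\<^bsub>F\<^esub>} = L"
  unfolding base_preimage_def L_def kernel_def by simp

lemma base_preimage_F: "base_preimage (carrier F) = kernel G A (snd \<circ> \<rho>)"
proof -
  have eq: "\<rho> g \<in> carrier F \<times> {\<one>\<^bsub>A\<^esub>} \<longleftrightarrow> snd (\<rho> g) = \<one>\<^bsub>A\<^esub>" if "g \<in> carrier G" for g
    using \<rho>.hom_closed[OF that] by (cases "\<rho> g") simp
  show ?thesis unfolding base_preimage_def kernel_def comp_def by (rule Collect_cong, rule conj_cong[OF HOL.refl], rule eq)
qed

lemma base_preimage_subgroup:
  assumes "subgroup B F"
  shows "subgroup (base_preimage B) G"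
proof -
  have "subgroup (B \<times> {\<one>\<^bsub>A\<^esub>}) Q"
  proof
    have inv_Q: "inv\<^bsub>Q\<^esub> (f, \<one>\<^bsub>A\<^esub>) = (inv\<^bsub>F\<^esub> f, \<one>\<^bsub>A\<^esub>)" if "f \<in> carrier F" for f
      using that by (intro Q.inv_equality) auto
    show "inv\<^bsub>Q\<^esub> q \<in> B \<times> {\<one>\<^bsub>A\<^esub>}" if "q \<in> B \<times> {\<one>\<^bsub>A\<^esub>}" for q
      using that assms by (auto simp: inv_Q subgroup.m_inv_closed subgroup.mem_carrier)
  qed (use assms in \<open>auto simp: subgroup.mem_carrier subgroup.m_closed subgroup.one_closed\<close>)
  then interpret B: subgroup "B \<times> {\<one>\<^bsub>A\<^esub>}" Q .
  show ?thesis
    unfolding base_preimage_def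
  proof
    show "\<one>\<^bsub>G\<^esub> \<in> {g \<in> carrier G. \<rho> g \<in> B \<times> {\<one>\<^bsub>A\<^esub>}}"
      using B.one_closed by (simp only: mem_Collect_eq G.one_closed \<rho>.hom_one simp_thms)
    show "inv\<^bsub>G\<^esub> g \<in> {g \<in> carrier G. \<rho> g \<in> B \<times> {\<one>\<^bsub>A\<^esub>}}"
      if "g \<in> {g \<in> carrier G. \<rho> g \<in> B \<times> {\<one>\<^bsub>A\<^esub>}}" for g
      using that B.m_inv_closed[of "\<rho> g"] by (simp only: mem_Collect_eq G.inv_closed \<rho>.hom_inv simp_thms)
    show "g \<otimes>\<^bsub>G\<^esub> g' \<in> {g \<in> carrier G. \<rho> g \<in> B \<times> {\<one>\<^bsub>A\<^esub>}}"
      if "g \<in> {g \<in> carrier G. \<rho> g \<in> B \<times> {\<one>\<^bsub>A\<^esub>}}" "g' \<in> {g \<in> carrier G. \<rho> g \<in> B \<times> {\<one>\<^bsub>A\<^esub>}}"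
      for g g'
      using that B.m_closed[of "\<rho> g" "\<rho> g'"] by (simp only: mem_Collect_eq G.m_closed \<rho>.hom_mult simp_thms)
  qed blast
qed

text \<open>
  On \<open>base_preimage C\<close> the \<open>A\<close>-component of \<open>\<rho>\<close> is trivial, so the
  \<open>F\<close>-component is a homomorphism onto \<open>C\<close>.
\<close>

lemma base_preimage_factor:
  assumes B: "subgroup B F" and C: "subgroup C F" and BC: "B \<lhd> F\<lparr>carrier := C\<rparr>"
  shows "base_preimage B \<lhd> G\<lparr>carrier := base_preimage C\<rparr>"
    and "G\<lparr>carrier := base_preimage C\<rparr> Mod base_preimage B \<cong> F\<lparr>carrier := C\<rparr> Mod B"
proof -
  let ?h = "fst \<circ> \<rho>"
  have sub: "B \<subseteq> C" using normal_imp_subgroup[OF BC] subgroup.subset by fastforce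
  have "?h \<in> hom (G\<lparr>carrier := base_preimage C\<rparr>) (F\<lparr>carrier := C\<rparr>)"
    by (rule homI) (auto simp: base_preimage_def \<rho>_prod simp del: \<rho>.hom_mult)
  then have hom: "group_hom (G\<lparr>carrier := base_preimage C\<rparr>) (F\<lparr>carrier := C\<rparr>) ?h"
    using G.subgroup_imp_group[OF base_preimage_subgroup[OF C]] F.subgroup_imp_group[OF C]
    by (simp add: group_hom_def group_hom_axioms_def)
  have "?h ` base_preimage C = C"
  proof
    show "C \<subseteq> ?h ` base_preimage C"
    proof
      fix f assume "f \<in> C"
      then show "f \<in> ?h ` base_preimage C"
        using subgroup.mem_carrier[OF C] by (intro image_eqI[of _ _ "j f"]) (auto simp: base_preimage_def)
    qed
  qed (auto simp: base_preimage_def)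
  then have surj: "?h ` carrier (G\<lparr>carrier := base_preimage C\<rparr>) = carrier (F\<lparr>carrier := C\<rparr>)" by simp
  have "{g \<in> carrier (G\<lparr>carrier := base_preimage C\<rparr>). ?h g \<in> B} = base_preimage B"
    using sub by (auto simp: base_preimage_def)
  then show "base_preimage B \<lhd> G\<lparr>carrier := base_preimage C\<rparr>"
    and "G\<lparr>carrier := base_preimage C\<rparr> Mod base_preimage B \<cong> F\<lparr>carrier := C\<rparr> Mod B"
    using preimage_normal_and_factor[OF hom surj BC] by simp_all
qed

lemma top_factor: "is_free (G Mod base_preimage (carrier F))"
proof -
  have "(snd \<circ> \<rho>) ` carrier G = carrier A"
    unfolding image_comp[symmetric] \<rho>_surj by (auto simp: image_iff)
  from \<pi>.FactGroup_iso[OF this] have iso: "G Mod base_preimage (carrier F) \<cong> A"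
    by (simp add: base_preimage_F)
  have gr: "group (G Mod base_preimage (carrier F))"
    unfolding base_preimage_F by (rule normal.factorgroup_is_group[OF \<pi>.normal_kernel])
  show ?thesis
    using group.iso_sym[OF gr iso] by (intro is_freeI[OF gr, of I]) (simp add: A_def)
qed

lemma bottom_factor:
  "{\<one>\<^bsub>G\<^esub>} \<lhd> G\<lparr>carrier := L\<rparr>" "is_free (G\<lparr>carrier := L\<rparr> Mod {\<one>\<^bsub>G\<^esub>})"
proof -
  let ?L = "G\<lparr>carrier := L\<rparr>"
  interpret L: group ?L by (rule G.subgroup_imp_group[OF L_subgroup])
  show n: "{\<one>\<^bsub>G\<^esub>} \<lhd> ?L" using L.one_is_normal by simp
  have iso: "?L Mod {\<one>\<^bsub>G\<^esub>} \<cong> ?L"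
    using is_isoI[OF L.trivial_factor_iso] by simp
  show "is_free (?L Mod {\<one>\<^bsub>G\<^esub>})"
    using normal.factorgroup_is_group[OF n]
    by (intro is_free_iso[OF L_free group.iso_sym[OF _ iso]])
qed

definition "lifted_series n N k =
  (if k = 0 then {\<one>\<^bsub>G\<^esub>} else if k \<le> Suc n then base_preimage (N (k - 1)) else carrier G)"

lemma poly_free_series_lifted:
  assumes N: "poly_free_series F n N"
  shows "poly_free_series G (n + 2) (lifted_series n N)"
proof -
  have N': "N 0 = {\<one>\<^bsub>F\<^esub>}" "N n = carrier F" "\<And>k. k \<le> n \<Longrightarrow> subgroup (N k) F"
    "\<And>k. k < n \<Longrightarrow> N k \<lhd> F\<lparr>carrier := N (Suc k)\<rparr>"
    "\<And>k. k < n \<Longrightarrow> is_free (F\<lparr>carrier := N (Suc k)\<rparr> Mod N k)"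
    using N unfolding poly_free_series_def by blast+
  have step: "lifted_series n N k \<lhd> G\<lparr>carrier := lifted_series n N (Suc k)\<rparr> \<and>
      is_free (G\<lparr>carrier := lifted_series n N (Suc k)\<rparr> Mod lifted_series n N k)"
    if k: "k < n + 2" for k
  proof -
    consider "k = 0" | l where "k = Suc l" "l < n" | "k = Suc n"
      using k by (cases k) (auto simp: less_Suc_eq)
    then show ?thesis
    proof cases
      case 1
      then show ?thesis using bottom_factor by (simp add: lifted_series_def N' base_preimage_one)
    next
      case 2
      note f = base_preimage_factor[OF N'(3)[of l] N'(3)[of "Suc l"] N'(4)[OF 2(2)]]
      have n: "base_preimage (N l) \<lhd> G\<lparr>carrier := base_preimage (N (Suc l))\<rparr>"
        and i: "G\<lparr>carrier := base_preimage (N (Suc l))\<rparr> Mod base_preimage (N l) \<cong> F\<lparr>carrier := N (Suc l)\<rparr> Mod N l"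
        using f 2 by simp_all
      have "is_free (G\<lparr>carrier := base_preimage (N (Suc l))\<rparr> Mod base_preimage (N l))"
        using normal.factorgroup_is_group[OF n]
        by (intro is_free_iso[OF N'(5)[OF 2(2)] group.iso_sym[OF _ i]])
      then show ?thesis using n 2 by (simp add: lifted_series_def)
    next
      case 3
      then show ?thesis
        using top_factor \<pi>.normal_kernel by (simp add: lifted_series_def N' base_preimage_F)
    qed
  qed
  have sub: "subgroup (lifted_series n N k) G" for k
    using base_preimage_subgroup[OF N'(3)[of "k - 1"]] G.triv_subgroup G.subgroup_self
    by (auto simp: lifted_series_def)
  have ends: "lifted_series n N 0 = {\<one>\<^bsub>G\<^esub>}" "lifted_series n N (n + 2) = carrier G"
    by (simp_all add: lifted_series_def)
  show ?thesis
    unfolding poly_free_series_def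
    by (intro conjI allI impI ends sub step[THEN conjunct1] step[THEN conjunct2])
qed

lemma poly_free_G: "poly_free F \<Longrightarrow> poly_free G"
  unfolding poly_free_def using poly_free_series_lifted G.is_group by blast

text \<open>
  For a general series of \<open>F\<close> the preimages need not be normal in \<open>G\<close>, since the
  automorphisms need not preserve its terms.  The series \<open>1 \<le> F\<close> is preserved.
\<close>

lemma normally_poly_free_G:
  assumes "is_free F"
  shows "normally_poly_free G"
proof -
  define N where "N k = (if k = 0 then {\<one>\<^bsub>F\<^esub>} else carrier F)" for k :: nat
  have "is_free (F Mod {\<one>\<^bsub>F\<^esub>})"
    using normal.factorgroup_is_group[OF F.one_is_normal]
    by (intro is_free_iso[OF assms group.iso_sym[OF _ is_isoI[OF F.trivial_factor_iso]]])
  moreover have "is_free (F\<lparr>carrier := carrier F\<rparr> Mod {\<one>\<^bsub>F\<^esub>}) = is_free (F Mod {\<one>\<^bsub>F\<^esub>})" by simp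
  ultimately have "poly_free_series F 1 N"
    using F.one_is_normal F.triv_subgroup F.subgroup_self
    by (auto simp: poly_free_series_def N_def)
  then have "poly_free_series G (1 + 2) (lifted_series 1 N)"
    by (rule poly_free_series_lifted)
  moreover have "lifted_series 1 N k \<lhd> G" for k
  proof -
    have "base_preimage (N l) \<lhd> G" for l
      using \<rho>.normal_kernel \<pi>.normal_kernel
      by (auto simp: N_def base_preimage_one base_preimage_F L_def)
    then show ?thesis
      using G.one_is_normal G.normal_self by (auto simp: lifted_series_def)
  qed
  ultimately show ?thesis unfolding normally_poly_free_def using G.is_group by blast
qed

end

theorem lemma5p1:
  fixes F :: "('a, 'b) monoid_scheme"
    and I :: "'i set"
    and H H' :: "'i \<Rightarrow> 'a set"
    and \<theta> :: "'i \<Rightarrow> 'a \<Rightarrow> 'a"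
  assumes "group F"
    and "\<And>i. i \<in> I \<Longrightarrow> subgroup (H i) F"
    and "\<And>i. i \<in> I \<Longrightarrow> subgroup (H' i) F"
    and "\<And>i. i \<in> I \<Longrightarrow> \<theta> i \<in> iso (F\<lparr>carrier := H i\<rparr>) (F\<lparr>carrier := H' i\<rparr>)"
    and "\<And>i. i \<in> I \<Longrightarrow> \<exists>\<phi> \<in> iso F F. \<forall>h \<in> H i. \<phi> h = \<theta> i h"
  shows "(poly_free F \<longrightarrow> poly_free (hnn_extension F I H \<theta>)) \<and>
         (is_free F \<longrightarrow> normally_poly_free (hnn_extension F I H \<theta>))"
proof -
  have "\<forall>i\<in>I. \<exists>\<phi>. \<phi> \<in> iso F F \<and> (\<forall>h\<in>H i. \<phi> h = \<theta> i h)" using assms(5) by blast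
  then obtain \<phi> where \<phi>: "\<And>i. i \<in> I \<Longrightarrow> \<phi> i \<in> iso F F"
      "\<And>i h. i \<in> I \<Longrightarrow> h \<in> H i \<Longrightarrow> \<phi> i h = \<theta> i h"
    by metis
  have "extendable_hnn F I H H' \<theta> \<phi>"
    using assms(1-4) \<phi>
    by (auto simp: extendable_hnn_def extendable_hnn_axioms_def iso_def bij_betw_def)
  then interpret extendable_hnn F I H H' \<theta> \<phi> .
  show ?thesis
    using poly_free_G normally_poly_free_G by (simp add: G_def)
qed

end
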